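(* Assume (A1)--(A5) of the context. For every continuously differentiable $f:\mathbb R^p\to\mathbb R$ (allowed to depend on $n$), $$\operatorname{Var}(f(\hat\theta))\le O\!\left(\frac1n\,\big\|\,|\nabla f(\hat\theta)|_2\,\big\|_{L^4}^2\right).$$
   Context: All objects form sequences indexed by $n$: $(p,X,L,\rho)=(p_n,X_n,L_n,\rho_n)$, dependence on $n$ being suppressed. For nonnegative sequences, $a_n=O(b_n)$ (also written $a_n\le O(b_n)$) means that there is a constant $C>0$ with $a_n\le Cb_n$ for all large enough $n$; implicit constants are deterministic and independent of $n$ and $p$. $|\cdot|_2$ is the Euclidean norm. For a real random variable $Y$ and $k>0$, $\|Y\|_{L^k}:=\mathbb E[|Y|^k]^{1/k}$. $X=(x_1,\dots,x_n)\in\mathbb R^{p\times n}$ is a random matrix with independent columns, $L:\mathbb R\to\mathbb R$, $\rho:\mathbb R^p\to\mathbb R$, and $$\Psi_X(\theta):=\frac1n\sum_{i=1}^n L(x_i^\top\theta)+\rho(\theta),\qquad \hat\theta:=\operatorname{argmin}_{\theta\in\mathbb R^p}\Psi_X(\theta).$$ Assumptions: (A1) $p=O(n)$. (A2) $|L'(0)|=O(1)$ and $|\nabla\rho(0)|_2=O(1)$. (A3) $\sup_{i\in[n]}|\mathbb E[x_i]|_2=O(1)$. (A4) There exists $C_P=O(1)$ such that for every $i\in[n]$ and every $C^1$ function $f:\mathbb R^p\to\mathbb R$ for which the right-hand side is finite, $\operatorname{Var}(f(x_i))\le C_P\,\mathbb E|\nabla f(x_i)|_2^2$. (A5) $L$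 is $C^2$, $\sup_t|L''(t)|=O(1)$, and there is $\kappa_L>0$ with $\kappa_L^{-1}=O(1)$ such that $L''(t)\ge\kappa_L$ for all $t\in\mathbb R$. $\rho$ is $C^2$ and there is $\kappa>0$ with $\kappa^{-1}=O(1)$ such that $\nabla^2\rho(\theta)\succeq\kappa I_p$ for all $\theta\in\mathbb R^p$. By (A5), $\Psi_X$ is strongly convex, so $\hat\theta$ is unique. *)

theory Defs
  imports "HOL-Probability.Probability" "HOL-Library.Landau_Symbols"
begin

(* The dimension p varies with n, so R^p is not a type of its own: a vector is an extensional
   function on the index set {..<p}.  Rn p is the space of the product sigma-algebra
   PiM {..<p} (\<lambda>_. borel), and the topology it inherits from nat \<Rightarrow> real is the usual one of R^p. *)
definition Rn :: "nat \<Rightarrow> (nat \<Rightarrow> real) set" where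
  "Rn p = (\<Pi>\<^sub>E j\<in>{..<p}. UNIV)"

abbreviation borel_Rn :: "nat \<Rightarrow> (nat \<Rightarrow> real) measure" where
  "borel_Rn p \<equiv> PiM {..<p} (\<lambda>_. borel)"

definition zero_Rn :: "nat \<Rightarrow> nat \<Rightarrow> real" where
  "zero_Rn p = (\<lambda>j\<in>{..<p}. 0)"

definition inner_Rn :: "nat \<Rightarrow> (nat \<Rightarrow> real) \<Rightarrow> (nat \<Rightarrow> real) \<Rightarrow> real" where
  "inner_Rn p x y = (\<Sum>j<p. x j * y j)"

abbreviation norm_Rn :: "nat \<Rightarrow> (nat \<Rightarrow> real) \<Rightarrow> real" where
  "norm_Rn p x \<equiv> L2_set x {..<p}"

definition partial_deriv :: "nat \<Rightarrow> ((nat \<Rightarrow> real) \<Rightarrow> real) \<Rightarrow> (nat \<Rightarrow> real) \<Rightarrow> real" where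
  "partial_deriv j f x = deriv (\<lambda>t. f (x(j := t))) (x j)"

definition gradient :: "nat \<Rightarrow> ((nat \<Rightarrow> real) \<Rightarrow> real) \<Rightarrow> (nat \<Rightarrow> real) \<Rightarrow> nat \<Rightarrow> real" where
  "gradient p f x = (\<lambda>j\<in>{..<p}. partial_deriv j f x)"

definition hessian :: "((nat \<Rightarrow> real) \<Rightarrow> real) \<Rightarrow> (nat \<Rightarrow> real) \<Rightarrow> nat \<Rightarrow> nat \<Rightarrow> real" where
  "hessian f x i j = partial_deriv i (partial_deriv j f) x"

(* All partial derivatives exist and are continuous on R^p; only the values of f on Rn p matter. *)
definition C1_Rn :: "nat \<Rightarrow> ((nat \<Rightarrow> real) \<Rightarrow> real) \<Rightarrow> bool" where
  "C1_Rn p f \<longleftrightarrow>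
     (\<forall>j<p. (\<forall>x\<in>Rn p. (\<lambda>t. f (x(j := t))) differentiable (at (x j))) \<and>
            continuous_on (Rn p) (partial_deriv j f))"

definition C2_Rn :: "nat \<Rightarrow> ((nat \<Rightarrow> real) \<Rightarrow> real) \<Rightarrow> bool" where
  "C2_Rn p f \<longleftrightarrow> C1_Rn p f \<and> (\<forall>j<p. C1_Rn p (partial_deriv j f))"

(* The Loewner order A \<succeq> c I for p \<times> p matrices A. *)
definition loewner_ge_scaled_id :: "nat \<Rightarrow> (nat \<Rightarrow> nat \<Rightarrow> real) \<Rightarrow> real \<Rightarrow> bool" where
  "loewner_ge_scaled_id p A c \<longleftrightarrow>
     (\<forall>v\<in>Rn p. (\<Sum>i<p. \<Sum>j<p. v i * A i j * v j) \<ge> c * inner_Rn p v v)"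

(* Variance with values in [0, \<infinity>]: it is \<infinity> when the expectation does not exist, so for measurable Y it
   is finite on a probability space iff Y is square integrable (the Bochner integral alone would yield 0 there). *)
definition ext_variance :: "'a measure \<Rightarrow> ('a \<Rightarrow> real) \<Rightarrow> ennreal" where
  "ext_variance M Y =
     (if integrable M Y
      then (\<integral>\<^sup>+\<omega>. ennreal ((Y \<omega> - (\<integral>\<omega>'. Y \<omega>' \<partial>M))\<^sup>2) \<partial>M)
      else \<infinity>)"

(* The L^k norm E[|Y|^k]^(1/k) with values in [0, \<infinity>], for k > 0. *)
definition Lk_norm :: "'a measure \<Rightarrow> real \<Rightarrow> ('a \<Rightarrow> real) \<Rightarrow> ennreal" where
  "Lk_norm M k Y =
     (if integrable M (\<lambda>\<omega>. \<bar>Y \<omega>\<bar> powr k)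
      then ennreal ((\<integral>\<omega>. \<bar>Y \<omega>\<bar> powr k \<partial>M) powr (1 / k))
      else \<infinity>)"

(* x i j is the j-th coordinate of the i-th column x_i, with i < n and j < p. *)
definition Psi ::
  "nat \<Rightarrow> nat \<Rightarrow> (nat \<Rightarrow> nat \<Rightarrow> real) \<Rightarrow> (real \<Rightarrow> real) \<Rightarrow> ((nat \<Rightarrow> real) \<Rightarrow> real) \<Rightarrow>
   (nat \<Rightarrow> real) \<Rightarrow> real" where
  "Psi n p x L \<rho> \<theta> = (1 / real n) * (\<Sum>i<n. L (inner_Rn p (x i) \<theta>)) + \<rho> \<theta>"

definition theta_hat ::
  "nat \<Rightarrow> nat \<Rightarrow> (nat \<Rightarrow> nat \<Rightarrow> real) \<Rightarrow> (real \<Rightarrow> real) \<Rightarrow> ((nat \<Rightarrow> real) \<Rightarrow> real) \<Rightarrow>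
   nat \<Rightarrow> real" where
  "theta_hat n p x L \<rho> = arg_min_on (Psi n p x L \<rho>) (Rn p)"

end

theory Submission
  imports Defs
begin

text \<open>
The minimiser \<open>\<theta>h(X)\<close> is a continuously differentiable and globally Lipschitz function of the data matrix \<open>X\<close>, with constant of
order \<open>n\<^bsup>-1/2\<^esup>\<close> for the Frobenius norm, and this holds for every data matrix, not only for typical ones.

The reason is strong convexity.  Testing the stationarity condition \<open>\<nabla>\<Psi>(\<theta>) = 0\<close> against the minimiser bounds
both \<open>|\<theta>|\<close> and the mean square of \<open>L'\<close> at the predictions \<open>a\<^sub>i = \<langle>x\<^sub>i, \<theta>\<rangle>\<close> by constants (\<open>a_priori\<close>,
\<open>mean_square_loss_slope\<close>).  Testing the difference of the stationarity conditions for two data matrices against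
the difference of their minimisers then yields the Lipschitz estimate (\<open>theta_hat_Lipschitz\<close>): the columns
\<open>x\<^sub>i\<close> themselves, which may be arbitrarily large, occur only through the predictions, whose increments are absorbed by the
convexity of \<open>L\<close>.

Differentiability follows because the difference quotients of the minimiser are bounded and solve linear
systems that converge to a coercive one (\<open>coercive_solution_stable\<close>,
\<open>theta_hat_directional_derivative_exists\<close>); the same argument shows that the derivative depends continuously on
the data.  The chain rule and the Lipschitz estimate give
\<open>\<Sum>\<^sub>i |\<nabla>\<^sub>x\<^sub>i (f \<circ> \<theta>h)|\<^sup>2 \<le> lip / n * |\<nabla>f(\<theta>h)|\<^sup>2\<close> pointwise (\<open>data_gradient_le\<close>).

The columns are independent, so the variance of \<open>f(\<theta>h(X))\<close> is at most the sum over the columns of the expected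
variances with all other columns frozen (\<open>Efron_Stein\<close>).  Each of these is controlled by the Poincare inequality
of that column, and the pointwise gradient bound gives \<open>Var f(\<theta>h) \<le> C\<^sub>P * lip / n * E |\<nabla>f(\<theta>h)|\<^sup>2\<close>
(\<open>variance_theta_hat\<close>).  By Jensen's inequality the last expectation is at most the square of the \<open>L\<^sup>4\<close> norm.
\<close>

section \<open>Continuously differentiable functions on \<^term>\<open>Rn p\<close>\<close>

lemma Rn_undefined: "x \<in> Rn p \<Longrightarrow> \<not> k < p \<Longrightarrow> x k = undefined"
  by (auto simp: Rn_def PiE_def extensional_def)

lemma Rn_upd: "x \<in> Rn p \<Longrightarrow> j < p \<Longrightarrow> x(j := t) \<in> Rn p"
  by (auto simp: Rn_def PiE_def extensional_def)

lemma Rn_restrict: "(\<lambda>k\<in>{..<p}. g k) \<in> Rn p"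
  by (auto simp: Rn_def)

lemma Rn_eqI:
  assumes "x \<in> Rn p" "y \<in> Rn p" "\<And>k. k < p \<Longrightarrow> x k = y k"
  shows "x = y"
proof
  fix k show "x k = y k"
    using assms Rn_undefined[of x p k] Rn_undefined[of y p k] by (cases "k < p") auto
qed

lemma tendsto_fun_coordwise:
  fixes g :: "'a \<Rightarrow> 'b \<Rightarrow> 'c::topological_space"
  assumes "\<And>k. ((\<lambda>a. g a k) \<longlongrightarrow> l k) F"
  shows "(g \<longlongrightarrow> l) F"
  using assms limitin_componentwise[of "\<lambda>_. euclidean" UNIV g l F]
  by (simp add: euclidean_product_topology)

text \<open>Outside \<^term>\<open>{..<p}\<close> all points of \<^term>\<open>Rn p\<close> agree, so convergence of the first \<open>p\<close> coordinates is
already convergence in the product topology.  Together with the converse below this turns every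
continuity argument on \<^term>\<open>Rn p\<close> into one about finitely many real coordinates along an arbitrary filter.\<close>

lemma continuous_on_Rn_tendsto:
  assumes "continuous_on (Rn p) \<phi>" and "x \<in> Rn p"
    and "eventually (\<lambda>a. y a \<in> Rn p) F"
    and "\<And>k. k < p \<Longrightarrow> ((\<lambda>a. y a k) \<longlongrightarrow> x k) F"
  shows "((\<lambda>a. \<phi> (y a)) \<longlongrightarrow> \<phi> x) F"
proof -
  have "((\<lambda>a. y a k) \<longlongrightarrow> x k) F" for k
  proof (cases "k < p")
    case False
    have "eventually (\<lambda>a. y a k = x k) F"
      using assms(3) by eventually_elim (simp add: Rn_undefined[OF _ False] \<open>x \<in> Rn p\<close>)
    then show ?thesis by (rule tendsto_eventually)
  qed (use assms in auto)
  then have "(y \<longlongrightarrow> x) F" by (rule tendsto_fun_coordwise)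
  then show ?thesis
    using continuous_on_tendsto_compose[OF assms(1) _ assms(2,3)] by blast
qed

lemma continuous_on_RnI:
  fixes \<phi> :: "(nat \<Rightarrow> real) \<Rightarrow> 'b::topological_space"
  assumes "\<And>x F. x \<in> Rn p \<Longrightarrow> eventually (\<lambda>y. y \<in> Rn p) F \<Longrightarrow>
             (\<And>k. k < p \<Longrightarrow> ((\<lambda>y. y k) \<longlongrightarrow> x k) F) \<Longrightarrow> (\<phi> \<longlongrightarrow> \<phi> x) F"
  shows "continuous_on (Rn p) \<phi>"
  unfolding continuous_on_def
proof
  fix x assume x: "x \<in> Rn p"
  have "((\<lambda>y. y k) \<longlongrightarrow> x k) (at x within Rn p)" for k
    using continuous_on_subset[OF continuous_on_product_coordinates[of k] subset_UNIV, of "Rn p"] x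
    unfolding continuous_on_def by blast
  moreover have "eventually (\<lambda>y. y \<in> Rn p) (at x within Rn p)"
    by (auto simp: eventually_at_filter)
  ultimately show "(\<phi> \<longlongrightarrow> \<phi> x) (at x within Rn p)" using assms[OF x] by blast
qed

lemma mean_value_segment:
  fixes \<phi> :: "real \<Rightarrow> real"
  assumes "\<And>t. (\<phi> has_real_derivative \<phi>' t) (at t)"
  shows "\<exists>\<xi>\<in>closed_segment a b. \<phi> b - \<phi> a = \<phi>' \<xi> * (b - a)"
proof -
  consider "a < b" | "b < a" | "a = b" by linarith
  then show ?thesis
  proof cases
    case 1
    from MVT2[OF this assms] obtain z where "a < z" "z < b" "\<phi> b - \<phi> a = (b - a) * \<phi>' z" by auto
    then show ?thesis by (intro bexI[of _ z]) (auto simp: closed_segment_eq_real_ivl)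
  next
    case 2
    from MVT2[OF this assms] obtain z where "b < z" "z < a" "\<phi> a - \<phi> b = (a - b) * \<phi>' z" by auto
    then show ?thesis by (intro bexI[of _ z]) (auto simp: closed_segment_eq_real_ivl algebra_simps)
  qed auto
qed

lemma C1_Rn_partial:
  assumes "C1_Rn p f" "x \<in> Rn p" "j < p"
  shows "((\<lambda>s. f (x(j := s))) has_real_derivative partial_deriv j f (x(j := t))) (at t)"
proof -
  have "(\<lambda>s. f (x(j := t, j := s))) differentiable (at t)"
    using assms Rn_upd[OF assms(2,3), of t] unfolding C1_Rn_def by (metis fun_upd_same)
  then have "(\<lambda>s. f (x(j := s))) differentiable (at t)" by simp
  then show ?thesis
    unfolding partial_deriv_def by (simp add: DERIV_deriv_iff_real_differentiable)
qed

text \<open>The points \<open>\<xi> j\<close> come from moving from \<open>x\<close> to \<open>y\<close> one coordinate at a time: the \<open>j\<close>-th move is a function of one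
real variable, to which the mean value theorem applies.  Each coordinate of \<open>\<xi> j\<close> stays between those
of \<open>x\<close> and \<open>y\<close>, so \<open>\<xi> j\<close> tends to \<open>x\<close> when \<open>y\<close> does.\<close>

lemma C1_Rn_mean_value:
  assumes f: "C1_Rn p f" and x: "x \<in> Rn p" and y: "y \<in> Rn p"
  shows "\<exists>\<xi>. (\<forall>j<p. \<xi> j \<in> Rn p \<and> (\<forall>k<p. \<xi> j k \<in> closed_segment (x k) (y k))) \<and>
             f y - f x = (\<Sum>j<p. partial_deriv j f (\<xi> j) * (y j - x j))"
proof -
  \<comment> \<open>\<open>h j\<close> has already moved its first \<open>j\<close> coordinates from \<open>x\<close> to \<open>y\<close>.\<close>
  define h where "h j = (\<lambda>k. if k < j then y k else x k)" for j
  have h_Rn: "h j \<in> Rn p" if "j \<le> p" for j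
    using x y that by (auto simp: h_def Rn_def PiE_def extensional_def)
  have h0: "h 0 = x" by (auto simp: h_def)
  have hp: "h p = y" by (rule Rn_eqI[OF h_Rn y]) (auto simp: h_def)
  have step: "\<exists>t\<in>closed_segment (x j) (y j).
      f (h (Suc j)) - f (h j) = partial_deriv j f ((h j)(j := t)) * (y j - x j)" if "j < p" for j
  proof -
    have "h (Suc j) = (h j)(j := y j)" "h j = (h j)(j := x j)"
      by (auto simp: h_def fun_eq_iff)
    then show ?thesis
      using mean_value_segment[OF C1_Rn_partial[OF f h_Rn that], of j "x j" "y j"] that by auto
  qed
  then obtain t where t: "\<And>j. j < p \<Longrightarrow> t j \<in> closed_segment (x j) (y j)"
    "\<And>j. j < p \<Longrightarrow> f (h (Suc j)) - f (h j) = partial_deriv j f ((h j)(j := t j)) * (y j - x j)"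
    by metis
  have "f y - f x = (\<Sum>j<p. f (h (Suc j)) - f (h j))"
    by (simp add: sum_lessThan_telescope[of "\<lambda>j. f (h j)"] h0 hp)
  also have "\<dots> = (\<Sum>j<p. partial_deriv j f ((h j)(j := t j)) * (y j - x j))"
    using t by simp
  finally show ?thesis
    using t(1) h_Rn Rn_upd
    by (intro exI[of _ "\<lambda>j. (h j)(j := t j)"]) (auto simp: h_def)
qed

lemma tendsto_in_segment:
  fixes z :: "'a \<Rightarrow> real"
  assumes "(y \<longlongrightarrow> x) F" "eventually (\<lambda>a. z a \<in> closed_segment x (y a)) F"
  shows "(z \<longlongrightarrow> x) F"
proof (rule Lim_null[THEN iffD2], rule Lim_null_comparison)
  show "eventually (\<lambda>a. norm (z a - x) \<le> \<bar>y a - x\<bar>) F"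
    using assms(2) by eventually_elim (auto simp: closed_segment_eq_real_ivl split: if_splits)
  show "((\<lambda>a. \<bar>y a - x\<bar>) \<longlongrightarrow> 0) F"
    using assms(1) by (intro tendsto_eq_intros) auto
qed

text \<open>A differentiability statement without norms: the increments of \<open>f\<close> are exactly linear in those of the
argument, with coefficients that converge to the partial derivatives.  Continuity, the chain rule and
the linear system for the derivative of the minimiser all follow by passing to the limit in these
coefficients.\<close>

lemma C1_Rn_slopes:
  assumes f: "C1_Rn p f" and x: "x \<in> Rn p" and ev: "eventually (\<lambda>a. y a \<in> Rn p) F"
    and lim: "\<And>k. k < p \<Longrightarrow> ((\<lambda>a. y a k) \<longlongrightarrow> x k) F"
  shows "\<exists>S. eventually (\<lambda>a. f (y a) - f x = (\<Sum>j<p. S j a * (y a j - x j))) F \<and>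
             (\<forall>j<p. (S j \<longlongrightarrow> partial_deriv j f x) F)"
proof -
  define P where "P a \<xi> \<longleftrightarrow> (\<forall>j<p. \<xi> j \<in> Rn p \<and> (\<forall>k<p. \<xi> j k \<in> closed_segment (x k) (y a k))) \<and>
             f (y a) - f x = (\<Sum>j<p. partial_deriv j f (\<xi> j) * (y a j - x j))" for a \<xi>
  define \<xi> where "\<xi> a = (SOME \<xi>. P a \<xi>)" for a
  have "P a (\<xi> a)" if "y a \<in> Rn p" for a
    unfolding \<xi>_def P_def by (rule someI_ex[OF C1_Rn_mean_value[OF f x that]])
  then have \<xi>: "\<And>a j. y a \<in> Rn p \<Longrightarrow> j < p \<Longrightarrow> \<xi> a j \<in> Rn p"
    "\<And>a j k. y a \<in> Rn p \<Longrightarrow> j < p \<Longrightarrow> k < p \<Longrightarrow> \<xi> a j k \<in> closed_segment (x k) (y a k)"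
    "\<And>a. y a \<in> Rn p \<Longrightarrow> f (y a) - f x = (\<Sum>j<p. partial_deriv j f (\<xi> a j) * (y a j - x j))"
    unfolding P_def by blast+
  show ?thesis
  proof (intro exI[of _ "\<lambda>j a. partial_deriv j f (\<xi> a j)"] conjI allI impI)
    show "eventually (\<lambda>a. f (y a) - f x = (\<Sum>j<p. partial_deriv j f (\<xi> a j) * (y a j - x j))) F"
      using ev by eventually_elim (rule \<xi>(3))
    fix j assume j: "j < p"
    show "((\<lambda>a. partial_deriv j f (\<xi> a j)) \<longlongrightarrow> partial_deriv j f x) F"
    proof (rule continuous_on_Rn_tendsto[OF _ x])
      show "continuous_on (Rn p) (partial_deriv j f)" using f j by (auto simp: C1_Rn_def)
      show "eventually (\<lambda>a. \<xi> a j \<in> Rn p) F"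
        using ev by eventually_elim (rule \<xi>(1)[OF _ j])
      fix k assume k: "k < p"
      show "((\<lambda>a. \<xi> a j k) \<longlongrightarrow> x k) F"
        by (rule tendsto_in_segment[OF lim[OF k]], use ev in eventually_elim) (rule \<xi>(2)[OF _ j k])
    qed
  qed
qed

lemma C1_Rn_continuous:
  assumes "C1_Rn p f"
  shows "continuous_on (Rn p) f"
proof (rule continuous_on_RnI)
  fix x F assume x: "x \<in> Rn p" and ev: "eventually (\<lambda>y. y \<in> Rn p) F"
    and lim: "\<And>k. k < p \<Longrightarrow> ((\<lambda>y. y k) \<longlongrightarrow> x k) F"
  from C1_Rn_slopes[OF assms x ev lim] obtain S where S:
    "eventually (\<lambda>y. f y - f x = (\<Sum>j<p. S j y * (y j - x j))) F \<and>
     (\<forall>j<p. (S j \<longlongrightarrow> partial_deriv j f x) F)" ..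
  have "((\<lambda>y. \<Sum>j<p. S j y * (y j - x j)) \<longlongrightarrow> (\<Sum>j<p. partial_deriv j f x * (x j - x j))) F"
    by (intro tendsto_sum tendsto_mult tendsto_diff S[THEN conjunct2, rule_format] lim tendsto_const) auto
  then have "((\<lambda>y. f y - f x) \<longlongrightarrow> 0) F"
    by (subst tendsto_cong[OF S[THEN conjunct1]]) simp
  then show "(f \<longlongrightarrow> f x) F" by (simp only: Lim_null[of f "f x" F])
qed

lemma C1_Rn_chain:
  assumes f: "C1_Rn p f" and \<gamma>: "\<And>t. \<gamma> t \<in> Rn p"
    and der: "\<And>k. k < p \<Longrightarrow> ((\<lambda>t. \<gamma> t k) has_real_derivative d k) (at t0)"
  shows "((\<lambda>t. f (\<gamma> t)) has_real_derivative (\<Sum>k<p. partial_deriv k f (\<gamma> t0) * d k)) (at t0)"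
proof -
  have lim: "((\<lambda>t. \<gamma> t k) \<longlongrightarrow> \<gamma> t0 k) (at t0)" if "k < p" for k
    using DERIV_isCont[OF der[OF that]] by (simp add: isCont_def)
  from C1_Rn_slopes[OF f \<gamma>[of t0], of \<gamma> "at t0", OF always_eventually[OF allI[OF \<gamma>]] lim]
  obtain S where S: "eventually (\<lambda>t. f (\<gamma> t) - f (\<gamma> t0) = (\<Sum>j<p. S j t * (\<gamma> t j - \<gamma> t0 j))) (at t0) \<and>
    (\<forall>j<p. (S j \<longlongrightarrow> partial_deriv j f (\<gamma> t0)) (at t0))" ..
  have ev: "eventually (\<lambda>t. (f (\<gamma> t) - f (\<gamma> t0)) / (t - t0) =
      (\<Sum>j<p. S j t * ((\<gamma> t j - \<gamma> t0 j) / (t - t0)))) (at t0)"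
    using S[THEN conjunct1] by eventually_elim (simp add: sum_divide_distrib)
  have "((\<lambda>t. \<Sum>j<p. S j t * ((\<gamma> t j - \<gamma> t0 j) / (t - t0))) \<longlongrightarrow>
         (\<Sum>k<p. partial_deriv k f (\<gamma> t0) * d k)) (at t0)"
    by (intro tendsto_intros S[THEN conjunct2, rule_format] der[unfolded has_field_derivative_iff]) auto
  then show ?thesis
    unfolding has_field_derivative_iff by (subst tendsto_cong[OF ev])
qed

lemma compact_Rn_box: "compact (\<Pi>\<^sub>E j\<in>{..<p}. {-R..R::real})"
proof -
  have eq: "(\<Pi>\<^sub>E j\<in>{..<p}. {-R..R::real}) = (\<Pi>\<^sub>E j\<in>UNIV. if j < p then {-R..R} else {undefined})"
    by (auto simp: PiE_def Pi_def extensional_def)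
  have "compactin (product_topology (\<lambda>_. euclidean) UNIV)
      (\<Pi>\<^sub>E j\<in>UNIV. if j < p then {-R..R::real} else {undefined})"
    by (subst compactin_PiE) auto
  then show ?thesis
    by (simp add: eq euclidean_product_topology compactin_euclidean_iff)
qed

text \<open>Outside a large cube the quadratic minorant exceeds the value at the origin, so the minimum over the
compact cube is global.\<close>

lemma coercive_attains_min:
  assumes G: "continuous_on (Rn p) G"
    and coer: "\<And>\<theta>. \<theta> \<in> Rn p \<Longrightarrow> c * inner_Rn p \<theta> \<theta> \<le> G \<theta> + b" and c: "c > 0"
  shows "\<exists>\<theta>\<in>Rn p. \<forall>y\<in>Rn p. G \<theta> \<le> G y"
proof -
  \<comment> \<open>The added 1 makes \<open>R\<close> positive and the comparison with the value at the origin strict.\<close>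
  define R where "R = sqrt (max 0 ((G (zero_Rn p) + b) / c)) + 1"
  let ?B = "\<Pi>\<^sub>E j\<in>{..<p}. {-R..R}"
  have R: "R > 0" "(G (zero_Rn p) + b) / c < R\<^sup>2"
  proof -
    show "R > 0" by (auto simp: R_def intro: add_nonneg_pos)
    have "max 0 ((G (zero_Rn p) + b) / c) = (R - 1)\<^sup>2" by (simp add: R_def)
    also have "\<dots> < R\<^sup>2" by (rule power_strict_mono) (auto simp: R_def)
    finally show "(G (zero_Rn p) + b) / c < R\<^sup>2" by simp
  qed
  have zero: "zero_Rn p \<in> ?B" using R by (auto simp: zero_Rn_def)
  have sub: "?B \<subseteq> Rn p" by (auto simp: Rn_def PiE_def)
  obtain \<theta> where \<theta>: "\<theta> \<in> ?B" "\<And>y. y \<in> ?B \<Longrightarrow> G \<theta> \<le> G y"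
    using continuous_attains_inf[OF compact_Rn_box _ continuous_on_subset[OF G sub]] zero by (metis empty_iff)
  have "G \<theta> \<le> G y" if y: "y \<in> Rn p" for y
  proof (cases "y \<in> ?B")
    case False
    then obtain j where j: "j < p" "\<bar>y j\<bar> > R"
      using y by (force simp: Rn_def PiE_def Pi_def)
    have "R\<^sup>2 \<le> y j * y j" using j(2) R(1) abs_le_square_iff[of R "y j"] by (auto simp: power2_eq_square)
    also have "\<dots> \<le> inner_Rn p y y"
      unfolding inner_Rn_def using j(1) by (intro member_le_sum) auto
    finally have "c * R\<^sup>2 \<le> c * inner_Rn p y y" using c by simp
    moreover have "G (zero_Rn p) + b < c * R\<^sup>2" using R(2) c by (simp add: field_simps)
    ultimately have "G (zero_Rn p) < G y" using coer[OF y] by linarith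
    then show ?thesis using \<theta>(2)[OF zero] by simp
  qed (use \<theta> in auto)
  then show ?thesis using subsetD[OF sub \<theta>(1)] by (intro bexI[of _ \<theta>] ballI)
qed

section \<open>Coercive linear systems\<close>

lemma inner_Rn_self: "inner_Rn p x x = (\<Sum>k<p. (x k)\<^sup>2)"
  by (simp add: inner_Rn_def power2_eq_square)

lemma inner_Rn_self_nonneg: "inner_Rn p x x \<ge> 0"
  unfolding inner_Rn_self by (simp add: sum_nonneg)

lemma norm_Rn_sq: "(norm_Rn p x)\<^sup>2 = inner_Rn p x x"
  by (simp add: L2_set_def inner_Rn_self sum_nonneg)

lemma loewner_ge_scaled_idD:
  assumes "loewner_ge_scaled_id p A c"
  shows "c * inner_Rn p v v \<le> (\<Sum>i<p. \<Sum>j<p. v i * A i j * v j)"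
proof -
  let ?v = "\<lambda>k\<in>{..<p}. v k"
  have "c * inner_Rn p ?v ?v \<le> (\<Sum>i<p. \<Sum>j<p. ?v i * A i j * ?v j)"
    using assms Rn_restrict unfolding loewner_ge_scaled_id_def by blast
  then show ?thesis by (simp add: inner_Rn_def)
qed

lemma young_inequality: "0 < c \<Longrightarrow> a * b \<le> c / 4 * a\<^sup>2 + b\<^sup>2 / c" for a b c :: real
proof -
  assume c: "0 < c"
  have "0 \<le> (c / 2 * a - b)\<^sup>2 / c" using c by simp
  also have "\<dots> = c / 4 * a\<^sup>2 + b\<^sup>2 / c - a * b"
    using c by (simp add: power2_eq_square field_simps)
  finally show ?thesis by simp
qed

text \<open>A matrix whose quadratic form is coercive need not be symmetric, so a solution of \<open>A w = b\<close> is found by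
minimising \<open>|A w - b|\<^sup>2\<close>.  If the residual \<open>r\<close> at a minimiser were nonzero, moving from \<open>w\<close> to \<open>w - s r\<close> would
change the objective by \<open>- 2 s \<langle>r, A r\<rangle> + s\<^sup>2 |A r|\<^sup>2\<close>, which is negative for small \<open>s > 0\<close> by coercivity.\<close>

lemma coercive_solvable:
  assumes A: "loewner_ge_scaled_id p A c" and c: "c > 0"
  shows "\<exists>w. \<forall>k<p. (\<Sum>l<p. A k l * w l) = b k"
proof -
  define r where "r w k = (\<Sum>l<p. A k l * w l) - b k" for w k
  define \<phi> where "\<phi> w = (\<Sum>k<p. (r w k)\<^sup>2)" for w
  have "c\<^sup>2 / 2 * inner_Rn p w w \<le> \<phi> w + (\<Sum>k<p. (b k)\<^sup>2)" for w
  proof -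
    have "c * inner_Rn p w w \<le> (\<Sum>k<p. w k * r w k + w k * b k)"
      using loewner_ge_scaled_idD[OF A, of w]
      by (simp add: r_def sum_distrib_left algebra_simps)
    also have "\<dots> \<le> (\<Sum>k<p. (c / 4 * (w k)\<^sup>2 + (r w k)\<^sup>2 / c) + (c / 4 * (w k)\<^sup>2 + (b k)\<^sup>2 / c))"
      by (intro sum_mono add_mono young_inequality c)
    also have "\<dots> = c / 2 * inner_Rn p w w + (\<phi> w + (\<Sum>k<p. (b k)\<^sup>2)) / c"
      by (simp add: sum.distrib inner_Rn_self \<phi>_def sum_divide_distrib add_divide_distrib sum_distrib_left)
    finally have "c / 2 * inner_Rn p w w \<le> (\<phi> w + (\<Sum>k<p. (b k)\<^sup>2)) / c" by linarith
    from mult_left_mono[OF this less_imp_le[OF c]] show ?thesis using c by (simp add: power2_eq_square)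
  qed
  moreover have "continuous_on (Rn p) \<phi>"
    by (rule continuous_on_RnI) (unfold \<phi>_def r_def, intro tendsto_intros, auto)
  ultimately obtain w where w: "\<And>y. y \<in> Rn p \<Longrightarrow> \<phi> w \<le> \<phi> y"
    using coercive_attains_min[of p \<phi> "c\<^sup>2 / 2" "\<Sum>k<p. (b k)\<^sup>2"] c by auto
  define Ar where "Ar k = (\<Sum>l<p. A k l * r w l)" for k
  define N where "N = (\<Sum>k<p. (Ar k)\<^sup>2)"
  have N: "N \<ge> 0" by (simp add: N_def sum_nonneg)
  have w': "\<phi> w \<le> \<phi> w - 2 * s * (\<Sum>k<p. r w k * Ar k) + s\<^sup>2 * N" for s
  proof -
    let ?w = "\<lambda>k\<in>{..<p}. w k - s * r w k"
    have rw': "r ?w k = r w k - s * Ar k" for k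
      by (simp add: r_def Ar_def algebra_simps sum_subtractf sum.distrib sum_distrib_left)
    have "\<phi> ?w = \<phi> w - 2 * s * (\<Sum>k<p. r w k * Ar k) + s\<^sup>2 * N"
      unfolding \<phi>_def N_def rw' power2_diff
      by (simp add: sum_subtractf sum.distrib sum_distrib_left power_mult_distrib mult_ac)
    then show ?thesis using w[OF Rn_restrict, of "\<lambda>k. w k - s * r w k"] by simp
  qed
  have "\<phi> w = 0"
  proof (rule ccontr)
    assume "\<phi> w \<noteq> 0"
    then have pos: "\<phi> w > 0" by (simp add: \<phi>_def sum_nonneg less_le)
    \<comment> \<open>Small enough that \<open>s N < 2 c |r|\<^sup>2\<close>; the added 1 covers \<open>N = 0\<close>.\<close>
    define s where "s = c * \<phi> w / (N + 1)"
    have s: "s > 0" using pos c N by (simp add: s_def)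
    have "c * \<phi> w \<le> (\<Sum>k<p. r w k * Ar k)"
      using loewner_ge_scaled_idD[OF A, of "r w"]
      by (simp add: \<phi>_def inner_Rn_self Ar_def sum_distrib_left mult.assoc)
    then have "2 * s * (c * \<phi> w) \<le> 2 * s * (\<Sum>k<p. r w k * Ar k)"
      using s by (intro mult_left_mono) auto
    with w'[of s] have "2 * s * (c * \<phi> w) \<le> s\<^sup>2 * N" by linarith
    then have "2 * (c * \<phi> w) \<le> s * N" using s by (simp add: power2_eq_square)
    also have "\<dots> = c * \<phi> w * (N / (N + 1))" by (simp add: s_def)
    also have "\<dots> \<le> c * \<phi> w * 1" using N c pos by (intro mult_left_mono) auto
    finally show False using c pos by simp
  qed
  then have "\<forall>k<p. r w k = 0"
    unfolding \<phi>_def by (subst (asm) sum_nonneg_eq_0_iff) auto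
  then show ?thesis by (auto simp: r_def)
qed

text \<open>Bounded solutions of linear systems converge when the systems converge and the limiting matrix is
coercive: with \<open>e = q - w\<close>, coercivity bounds \<open>c |e|\<^sup>2\<close> by \<open>\<langle>e, H e\<rangle>\<close>, and \<open>H e = (H - A) q + (b - b0)\<close> tends to zero.
Coercivity is asked of the limit because the matrices arising from difference quotients are not Hessians
at a single point.\<close>

lemma coercive_solution_stable:
  assumes H: "loewner_ge_scaled_id p H c" "c > 0"
    and eq: "eventually (\<lambda>a. \<forall>k<p. (\<Sum>l<p. A a k l * q a l) = b a k) F"
    and A: "\<And>k l. k < p \<Longrightarrow> l < p \<Longrightarrow> ((\<lambda>a. A a k l) \<longlongrightarrow> H k l) F"
    and b: "\<And>k. k < p \<Longrightarrow> ((\<lambda>a. b a k) \<longlongrightarrow> b0 k) F"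
    and K: "eventually (\<lambda>a. \<forall>k<p. \<bar>q a k\<bar> \<le> K) F"
    and w: "\<And>k. k < p \<Longrightarrow> (\<Sum>l<p. H k l * w l) = b0 k"
    and l: "l < p"
  shows "((\<lambda>a. q a l) \<longlongrightarrow> w l) F"
proof -
  define E where "E a = (\<Sum>k<p. (K + \<bar>w k\<bar>) * ((\<Sum>l<p. \<bar>A a k l - H k l\<bar> * K) + \<bar>b a k - b0 k\<bar>)) / c" for a
  have "(E \<longlongrightarrow> (\<Sum>k<p. (K + \<bar>w k\<bar>) * ((\<Sum>l<p. \<bar>H k l - H k l\<bar> * K) + \<bar>b0 k - b0 k\<bar>)) / c) F"
    unfolding E_def using H(2) by (intro tendsto_intros A b) auto
  then have E0: "((\<lambda>a. sqrt (E a)) \<longlongrightarrow> 0) F" by (simp add: tendsto_real_sqrt[where x = 0, simplified])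
  have "eventually (\<lambda>a. norm (q a l - w l) \<le> sqrt (E a)) F"
    using eq K
  proof eventually_elim
    case (elim a)
    define e where "e k = q a k - w k" for k
    have res: "(\<Sum>l<p. H k l * e l) = (\<Sum>l<p. (H k l - A a k l) * q a l) + (b a k - b0 k)" if "k < p" for k
      using w[OF that] elim(1)[rule_format, OF that]
      by (simp add: e_def algebra_simps sum_subtractf)
    have "c * inner_Rn p e e \<le> (\<Sum>k<p. e k * (\<Sum>l<p. H k l * e l))"
      using loewner_ge_scaled_idD[OF H(1), of e] by (simp add: sum_distrib_left mult.assoc)
    also have "\<dots> \<le> (\<Sum>k<p. (K + \<bar>w k\<bar>) * ((\<Sum>l<p. \<bar>A a k l - H k l\<bar> * K) + \<bar>b a k - b0 k\<bar>))"
    proof (rule sum_mono)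
      fix k assume "k \<in> {..<p}"
      then have k: "k < p" by simp
      have He: "\<bar>\<Sum>l<p. H k l * e l\<bar> \<le> (\<Sum>l<p. \<bar>A a k l - H k l\<bar> * K) + \<bar>b a k - b0 k\<bar>"
        unfolding res[OF k]
      proof (rule order_trans[OF abs_triangle_ineq add_right_mono])
        show "\<bar>\<Sum>l<p. (H k l - A a k l) * q a l\<bar> \<le> (\<Sum>l<p. \<bar>A a k l - H k l\<bar> * K)"
          using elim(2) by (intro order_trans[OF sum_abs] sum_mono)
            (auto simp: abs_mult abs_minus_commute intro!: mult_left_mono)
      qed
      have ek: "\<bar>e k\<bar> \<le> K + \<bar>w k\<bar>" using elim(2)[rule_format, OF k] unfolding e_def by linarith
      have "e k * (\<Sum>l<p. H k l * e l) \<le> \<bar>e k\<bar> * \<bar>\<Sum>l<p. H k l * e l\<bar>"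
        by (simp add: abs_mult[symmetric])
      also have "\<dots> \<le> (K + \<bar>w k\<bar>) * ((\<Sum>l<p. \<bar>A a k l - H k l\<bar> * K) + \<bar>b a k - b0 k\<bar>)"
        using ek by (intro mult_mono ek He) auto
      finally show "e k * (\<Sum>l<p. H k l * e l)
          \<le> (K + \<bar>w k\<bar>) * ((\<Sum>l<p. \<bar>A a k l - H k l\<bar> * K) + \<bar>b a k - b0 k\<bar>)"
        .
    qed
    finally have "inner_Rn p e e \<le> E a" using H(2) by (simp add: E_def field_simps)
    moreover have "(e l)\<^sup>2 \<le> inner_Rn p e e"
      unfolding inner_Rn_self using l by (intro member_le_sum) auto
    ultimately have "(e l)\<^sup>2 \<le> E a" by simp
    then show "norm (q a l - w l) \<le> sqrt (E a)" using real_le_rsqrt[of "\<bar>e l\<bar>" "E a"] by (simp add: e_def)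
  qed
  then have "((\<lambda>a. q a l - w l) \<longlongrightarrow> 0) F" by (rule Lim_null_comparison[OF _ E0])
  then show ?thesis by (simp only: Lim_null[of "\<lambda>a. q a l" "w l"])
qed

lemma coercive_solution_unique:
  assumes H: "loewner_ge_scaled_id p H c" "c > 0"
    and "\<And>k. k < p \<Longrightarrow> (\<Sum>l<p. H k l * v l) = (\<Sum>l<p. H k l * w l)" and "k < p"
  shows "v k = w k"
proof -
  have "(\<Sum>l<p. H j l * (v l - w l)) = 0" if "j < p" for j
    using assms(3)[OF that] by (simp add: algebra_simps sum_subtractf)
  then have "c * inner_Rn p (\<lambda>k. v k - w k) (\<lambda>k. v k - w k) \<le> 0"
    using loewner_ge_scaled_idD[OF H(1), of "\<lambda>k. v k - w k"]
    by (simp add: mult.assoc sum_distrib_left[symmetric])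
  then have "inner_Rn p (\<lambda>k. v k - w k) (\<lambda>k. v k - w k) = 0"
    using H(2) inner_Rn_self_nonneg[of p "\<lambda>k. v k - w k"] by (simp add: mult_le_0_iff)
  then show ?thesis
    using \<open>k < p\<close> unfolding inner_Rn_self by (subst (asm) sum_nonneg_eq_0_iff) auto
qed

section \<open>Strong convexity from a lower bound on the Hessian\<close>

text \<open>The first two derivatives of \<open>\<rho>\<close> along the segment from \<open>x\<close> to \<open>y\<close>: the chain rule for \<open>\<rho>\<close> and then for each of
its partial derivatives.  They reduce convexity to one real variable.\<close>

lemma segment_derivs:
  assumes x: "x \<in> Rn p" and y: "y \<in> Rn p" and \<rho>: "C2_Rn p \<rho>"
  defines "\<gamma> \<equiv> \<lambda>t. \<lambda>k\<in>{..<p}. x k + t * (y k - x k)"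
  shows "\<gamma> t \<in> Rn p" "\<gamma> 0 = x" "\<gamma> 1 = y"
    and "((\<lambda>t. \<rho> (\<gamma> t)) has_real_derivative (\<Sum>k<p. partial_deriv k \<rho> (\<gamma> t) * (y k - x k))) (at t)"
    and "((\<lambda>t. \<Sum>k<p. partial_deriv k \<rho> (\<gamma> t) * (y k - x k)) has_real_derivative
           (\<Sum>l<p. \<Sum>k<p. (y l - x l) * hessian \<rho> (\<gamma> t) l k * (y k - x k))) (at t)"
proof -
  show R: "\<gamma> t \<in> Rn p" for t unfolding \<gamma>_def by (rule Rn_restrict)
  show "\<gamma> 0 = x" "\<gamma> 1 = y" by (rule Rn_eqI[OF R]; use x y in \<open>simp add: \<gamma>_def\<close>)+
  have der: "((\<lambda>t. \<gamma> t k) has_real_derivative (y k - x k)) (at t)" if "k < p" for k t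
    using that by (auto simp: \<gamma>_def intro!: derivative_eq_intros)
  show "((\<lambda>t. \<rho> (\<gamma> t)) has_real_derivative (\<Sum>k<p. partial_deriv k \<rho> (\<gamma> t) * (y k - x k))) (at t)"
    using \<rho> by (intro C1_Rn_chain R der) (auto simp: C2_Rn_def)
  have "((\<lambda>t. \<Sum>k<p. partial_deriv k \<rho> (\<gamma> t) * (y k - x k)) has_real_derivative
      (\<Sum>k<p. (\<Sum>l<p. partial_deriv l (partial_deriv k \<rho>) (\<gamma> t) * (y l - x l)) * (y k - x k))) (at t)"
    using \<rho> by (intro DERIV_sum DERIV_cmult_right C1_Rn_chain[where \<gamma> = \<gamma>] R der) (auto simp: C2_Rn_def)
  also have "(\<Sum>k<p. (\<Sum>l<p. partial_deriv l (partial_deriv k \<rho>) (\<gamma> t) * (y l - x l)) * (y k - x k)) =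
      (\<Sum>l<p. \<Sum>k<p. (y l - x l) * hessian \<rho> (\<gamma> t) l k * (y k - x k))"
    by (subst sum.swap) (simp add: hessian_def sum_distrib_left mult_ac)
  finally show "((\<lambda>t. \<Sum>k<p. partial_deriv k \<rho> (\<gamma> t) * (y k - x k)) has_real_derivative
           (\<Sum>l<p. \<Sum>k<p. (y l - x l) * hessian \<rho> (\<gamma> t) l k * (y k - x k))) (at t)" .
qed

text \<open>The lower bound on the Hessian makes the slope of \<open>\<rho>\<close> along the segment grow at rate at least
\<open>c |y - x|\<^sup>2\<close>.  At the end point this is strong monotonicity of the gradient; integrating once more gives
the quadratic minorant.\<close>

lemma strongly_monotone_gradient_segment:
  assumes x: "x \<in> Rn p" and y: "y \<in> Rn p" and \<rho>: "C2_Rn p \<rho>"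
    and H: "\<And>\<theta>. \<theta> \<in> Rn p \<Longrightarrow> loewner_ge_scaled_id p (hessian \<rho> \<theta>) c" and t: "t \<ge> 0"
  shows "(\<Sum>k<p. partial_deriv k \<rho> (\<lambda>k\<in>{..<p}. x k + t * (y k - x k)) * (y k - x k))
    \<ge> (\<Sum>k<p. partial_deriv k \<rho> x * (y k - x k)) + t * (c * inner_Rn p (\<lambda>k. y k - x k) (\<lambda>k. y k - x k))"
proof -
  define \<gamma> where "\<gamma> t = (\<lambda>k\<in>{..<p}. x k + t * (y k - x k))" for t
  note seg = segment_derivs[OF x y \<rho>, folded \<gamma>_def]
  let ?\<psi> = "\<lambda>t. (\<Sum>k<p. partial_deriv k \<rho> (\<gamma> t) * (y k - x k))"
  let ?d = "c * inner_Rn p (\<lambda>k. y k - x k) (\<lambda>k. y k - x k)"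
  have "?\<psi> 0 - 0 * ?d \<le> ?\<psi> t - t * ?d"
  proof (rule DERIV_nonneg_imp_nondecreasing[OF t])
    fix s
    have "((\<lambda>t. ?\<psi> t - t * ?d) has_real_derivative
        (\<Sum>l<p. \<Sum>k<p. (y l - x l) * hessian \<rho> (\<gamma> s) l k * (y k - x k)) - 1 * ?d) (at s)"
      by (intro DERIV_diff seg DERIV_cmult_right DERIV_ident)
    then show "\<exists>d. ((\<lambda>t. ?\<psi> t - t * ?d) has_real_derivative d) (at s) \<and> 0 \<le> d"
      using loewner_ge_scaled_idD[OF H[OF seg(1)[of s]], of "\<lambda>k. y k - x k"] by force
  qed
  then show ?thesis using seg(2) by (simp add: \<gamma>_def)
qed

lemma strongly_monotone_gradient:
  assumes x: "x \<in> Rn p" and y: "y \<in> Rn p" and \<rho>: "C2_Rn p \<rho>"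
    and H: "\<And>\<theta>. \<theta> \<in> Rn p \<Longrightarrow> loewner_ge_scaled_id p (hessian \<rho> \<theta>) c"
  shows "(\<Sum>k<p. (partial_deriv k \<rho> y - partial_deriv k \<rho> x) * (y k - x k))
    \<ge> c * inner_Rn p (\<lambda>k. y k - x k) (\<lambda>k. y k - x k)"
  using strongly_monotone_gradient_segment[OF x y \<rho> H, where t = 1, simplified] segment_derivs(3)[OF x y \<rho>]
  by (simp add: left_diff_distrib sum_subtractf)

lemma strongly_convex_quadratic_minorant:
  assumes x: "x \<in> Rn p" and y: "y \<in> Rn p" and \<rho>: "C2_Rn p \<rho>"
    and H: "\<And>\<theta>. \<theta> \<in> Rn p \<Longrightarrow> loewner_ge_scaled_id p (hessian \<rho> \<theta>) c"
  shows "\<rho> y \<ge> \<rho> x + (\<Sum>k<p. partial_deriv k \<rho> x * (y k - x k))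
               + c / 2 * inner_Rn p (\<lambda>k. y k - x k) (\<lambda>k. y k - x k)"
proof -
  define \<gamma> where "\<gamma> t = (\<lambda>k\<in>{..<p}. x k + t * (y k - x k))" for t
  note seg = segment_derivs[OF x y \<rho>, folded \<gamma>_def]
  let ?\<psi> = "\<lambda>t. (\<Sum>k<p. partial_deriv k \<rho> (\<gamma> t) * (y k - x k))"
  let ?i = "c * inner_Rn p (\<lambda>k. y k - x k) (\<lambda>k. y k - x k)"
  let ?h = "\<lambda>t. \<rho> (\<gamma> t) - t * ?\<psi> 0 - t\<^sup>2 * (?i / 2)"
  have "?h 0 \<le> ?h 1"
  proof (rule DERIV_nonneg_imp_nondecreasing[where f = ?h and a = 0 and b = 1])
    fix s :: real assume "0 \<le> s"
    have "(?h has_real_derivative (?\<psi> s - 1 * ?\<psi> 0 - (2 * s) * (?i / 2))) (at s)"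
      by (intro DERIV_diff seg DERIV_cmult_right DERIV_ident) (auto intro!: derivative_eq_intros)
    moreover have "?\<psi> s \<ge> ?\<psi> 0 + s * ?i"
      using strongly_monotone_gradient_segment[OF x y \<rho> H \<open>0 \<le> s\<close>] seg(2) by (simp add: \<gamma>_def)
    ultimately show "\<exists>d. (?h has_real_derivative d) (at s) \<and> 0 \<le> d" by force
  qed simp
  then show ?thesis using seg(2,3) by simp
qed

section \<open>The Efron--Stein inequality for product measures\<close>

text \<open>The case of two independent variables.  With the conditional means \<open>A(x)\<close> and \<open>C(y)\<close> and the mean \<open>m\<close>, expanding
\<open>0 \<le> E (f - A - C + m)\<^sup>2\<close> gives \<open>E A\<^sup>2 + E C\<^sup>2 \<le> E f\<^sup>2 + m\<^sup>2\<close>, a rearrangement of the claim.\<close>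

lemma (in pair_prob_space) variance_le_sum_conditional:
  fixes f :: "_ \<Rightarrow> real"
  assumes f: "f \<in> borel_measurable (M1 \<Otimes>\<^sub>M M2)" and B: "\<And>z. z \<in> space (M1 \<Otimes>\<^sub>M M2) \<Longrightarrow> \<bar>f z\<bar> \<le> B"
  shows "(\<integral>z. (f z)\<^sup>2 \<partial>(M1 \<Otimes>\<^sub>M M2)) - (\<integral>z. f z \<partial>(M1 \<Otimes>\<^sub>M M2))\<^sup>2
     \<le> (\<integral>x. (\<integral>y. (f (x, y))\<^sup>2 \<partial>M2) - (\<integral>y. f (x, y) \<partial>M2)\<^sup>2 \<partial>M1)
      + (\<integral>y. (\<integral>x. (f (x, y))\<^sup>2 \<partial>M1) - (\<integral>x. f (x, y) \<partial>M1)\<^sup>2 \<partial>M2)"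
proof -
  note [measurable] = f
  define A where "A x = (\<integral>y. f (x, y) \<partial>M2)" for x
  define C where "C y = (\<integral>x. f (x, y) \<partial>M1)" for y
  define m where "m = (\<integral>z. f z \<partial>(M1 \<Otimes>\<^sub>M M2))"
  have A_meas [measurable]: "A \<in> borel_measurable M1" unfolding A_def by measurable
  have C_meas [measurable]: "C \<in> borel_measurable M2" unfolding C_def by measurable
  have f1: "integrable M2 (\<lambda>y. f (x, y))" if "x \<in> space M1" for x
    using that by (intro M2.integrable_const_bound[where B = B]) (auto simp: B space_pair_measure)
  have f2: "integrable M1 (\<lambda>x. f (x, y))" if "y \<in> space M2" for y
    using that by (intro M1.integrable_const_bound[where B = B]) (auto simp: B space_pair_measure)
  have A_le: "\<bar>A x\<bar> \<le> B" if "x \<in> space M1" for x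
  proof -
    have "\<bar>A x\<bar> \<le> (\<integral>y. \<bar>f (x, y)\<bar> \<partial>M2)" unfolding A_def by (rule integral_abs_bound)
    also have "\<dots> \<le> (\<integral>y. B \<partial>M2)"
      using that f1 by (intro integral_mono) (auto simp: B space_pair_measure)
    finally show ?thesis by (simp add: M2.prob_space)
  qed
  have C_le: "\<bar>C y\<bar> \<le> B" if "y \<in> space M2" for y
  proof -
    have "\<bar>C y\<bar> \<le> (\<integral>x. \<bar>f (x, y)\<bar> \<partial>M1)" unfolding C_def by (rule integral_abs_bound)
    also have "\<dots> \<le> (\<integral>x. B \<partial>M1)"
      using that f2 by (intro integral_mono) (auto simp: B space_pair_measure)
    finally show ?thesis by (simp add: M1.prob_space)
  qed
  have prod_le: "\<bar>u * v\<bar> \<le> B * B" if "\<bar>u\<bar> \<le> B" "\<bar>v\<bar> \<le> B" for u v :: real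
    using that unfolding abs_mult by (intro mult_mono) auto
  have sq_le: "u * u \<le> B * B" if "\<bar>u\<bar> \<le> B" for u :: real
    using prod_le[OF that that] by simp
  have int: "integrable (M1 \<Otimes>\<^sub>M M2) (\<lambda>z. u z * v z)"
    if "u \<in> borel_measurable (M1 \<Otimes>\<^sub>M M2)" "v \<in> borel_measurable (M1 \<Otimes>\<^sub>M M2)"
      "\<And>z. z \<in> space (M1 \<Otimes>\<^sub>M M2) \<Longrightarrow> \<bar>u z\<bar> \<le> B" "\<And>z. z \<in> space (M1 \<Otimes>\<^sub>M M2) \<Longrightarrow> \<bar>v z\<bar> \<le> B" for u v
    using that by (intro P.integrable_const_bound[where B = "B * B"]) (auto simp: prod_le)
  have f_int: "integrable (M1 \<Otimes>\<^sub>M M2) f"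
    by (intro P.integrable_const_bound[where B = B]) (auto simp: B)
  have le: "\<bar>A (fst z)\<bar> \<le> B" "\<bar>C (snd z)\<bar> \<le> B" "\<bar>f z\<bar> \<le> B" if "z \<in> space (M1 \<Otimes>\<^sub>M M2)" for z
    using that A_le C_le B by (auto simp: space_pair_measure)
  have A1: "integrable M1 A" "integrable M1 (\<lambda>x. A x * A x)"
    by (rule M1.integrable_const_bound[where B = B], simp add: A_le, simp)
       (rule M1.integrable_const_bound[where B = "B * B"], auto intro!: AE_I2 simp: sq_le A_le)
  have C1: "integrable M2 C" "integrable M2 (\<lambda>y. C y * C y)"
    by (rule M2.integrable_const_bound[where B = B], simp add: C_le, simp)
       (rule M2.integrable_const_bound[where B = "B * B"], auto intro!: AE_I2 simp: sq_le C_le)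
  have A_int: "integrable (M1 \<Otimes>\<^sub>M M2) (\<lambda>z. A (fst z))" and C_int: "integrable (M1 \<Otimes>\<^sub>M M2) (\<lambda>z. C (snd z))"
    by (auto intro!: P.integrable_const_bound[where B = B] simp: le)
  have EA: "(\<integral>z. A (fst z) \<partial>(M1 \<Otimes>\<^sub>M M2)) = m"
    using integral_fst'[OF A_int] integral_fst'[OF f_int] by (simp add: M2.prob_space A_def m_def)
  have EA1: "(\<integral>x. A x \<partial>M1) = m"
    using integral_fst'[OF f_int] by (simp add: A_def m_def)
  have EC1: "(\<integral>y. C y \<partial>M2) = m"
    using integral_snd[of "\<lambda>x y. f (x, y)"] f_int by (simp add: C_def m_def case_prod_unfold)
  have EC: "(\<integral>z. C (snd z) \<partial>(M1 \<Otimes>\<^sub>M M2)) = m"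
    using integral_fst'[OF C_int] by (simp add: M1.prob_space EC1)
  have i: "integrable (M1 \<Otimes>\<^sub>M M2) (\<lambda>z. f z * f z)" "integrable (M1 \<Otimes>\<^sub>M M2) (\<lambda>z. f z * A (fst z))"
    "integrable (M1 \<Otimes>\<^sub>M M2) (\<lambda>z. f z * C (snd z))" "integrable (M1 \<Otimes>\<^sub>M M2) (\<lambda>z. A (fst z) * A (fst z))"
    "integrable (M1 \<Otimes>\<^sub>M M2) (\<lambda>z. C (snd z) * C (snd z))" "integrable (M1 \<Otimes>\<^sub>M M2) (\<lambda>z. A (fst z) * C (snd z))"
    by (rule int; simp add: le)+
  have EfA: "(\<integral>z. f z * A (fst z) \<partial>(M1 \<Otimes>\<^sub>M M2)) = (\<integral>x. A x * A x \<partial>M1)"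
    using integral_fst'[OF i(2)] by (simp add: A_def)
  have EfC: "(\<integral>z. f z * C (snd z) \<partial>(M1 \<Otimes>\<^sub>M M2)) = (\<integral>y. C y * C y \<partial>M2)"
    using integral_snd[of "\<lambda>x y. f (x, y) * C y"] i(3) by (simp add: C_def case_prod_unfold)
  have EAA: "(\<integral>z. A (fst z) * A (fst z) \<partial>(M1 \<Otimes>\<^sub>M M2)) = (\<integral>x. A x * A x \<partial>M1)"
    using integral_fst'[OF i(4)] by (simp add: M2.prob_space)
  have ECC: "(\<integral>z. C (snd z) * C (snd z) \<partial>(M1 \<Otimes>\<^sub>M M2)) = (\<integral>y. C y * C y \<partial>M2)"
    using integral_fst'[OF i(5)] by (simp add: M1.prob_space)
  have EAC: "(\<integral>z. A (fst z) * C (snd z) \<partial>(M1 \<Otimes>\<^sub>M M2)) = m * m"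
    using integral_fst'[OF i(6)] by (simp add: EC1 EA1)
  have "0 \<le> (\<integral>z. (f z - A (fst z) - C (snd z) + m)\<^sup>2 \<partial>(M1 \<Otimes>\<^sub>M M2))" by simp
  also have "\<dots> = (\<integral>z. f z * f z + A (fst z) * A (fst z) + C (snd z) * C (snd z) + m * m
      - 2 * (f z * A (fst z)) - 2 * (f z * C (snd z)) + 2 * m * f z + 2 * (A (fst z) * C (snd z))
      - 2 * m * A (fst z) - 2 * m * C (snd z) \<partial>(M1 \<Otimes>\<^sub>M M2))"
    by (intro Bochner_Integration.integral_cong refl) (simp add: power2_eq_square algebra_simps)
  also have "\<dots> = (\<integral>z. f z * f z \<partial>(M1 \<Otimes>\<^sub>M M2)) + m * m - (\<integral>x. A x * A x \<partial>M1) - (\<integral>y. C y * C y \<partial>M2)"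
    using i f_int A_int C_int
    by (simp add: EA EC EfA EfC EAA ECC EAC m_def[symmetric] P.prob_space)
  finally have key: "(\<integral>x. A x * A x \<partial>M1) + (\<integral>y. C y * C y \<partial>M2) \<le> (\<integral>z. f z * f z \<partial>(M1 \<Otimes>\<^sub>M M2)) + m * m"
    by simp
  have "(\<integral>x. (\<integral>y. f (x, y) * f (x, y) \<partial>M2) - A x * A x \<partial>M1)
      = (\<integral>z. f z * f z \<partial>(M1 \<Otimes>\<^sub>M M2)) - (\<integral>x. A x * A x \<partial>M1)"
    using integrable_fst'[OF i(1)] A1(2) integral_fst'[OF i(1)] by simp
  moreover have "(\<integral>y. (\<integral>x. f (x, y) * f (x, y) \<partial>M1) - C y * C y \<partial>M2)
      = (\<integral>z. f z * f z \<partial>(M1 \<Otimes>\<^sub>M M2)) - (\<integral>y. C y * C y \<partial>M2)"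
    using integrable_snd[of "\<lambda>x y. f (x, y) * f (x, y)"] integral_snd[of "\<lambda>x y. f (x, y) * f (x, y)"] i(1) C1(2)
    by (simp add: case_prod_unfold)
  ultimately show ?thesis
    using key unfolding power2_eq_square A_def[symmetric] C_def[symmetric] m_def[symmetric] by linarith
qed

text \<open>The induction splits off one coordinate at a time with the two-variable case.  The conditional variances
are replaced by the integrals of arbitrary majorants \<open>G i\<close> from the start, because the inequality for the
remaining coordinates is applied to every section of \<open>f\<close>, and majorants pass to sections.  Variances are
written as \<open>E f\<^sup>2 - (E f)\<^sup>2\<close>.\<close>

lemma Efron_Stein:
  fixes f :: "('i \<Rightarrow> 'a) \<Rightarrow> real"
  assumes "finite I" and "\<And>i. i \<in> I \<Longrightarrow> prob_space (M i)"
    and "f \<in> borel_measurable (PiM I M)" and "\<And>x. x \<in> space (PiM I M) \<Longrightarrow> \<bar>f x\<bar> \<le> B"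
    and "\<And>i. i \<in> I \<Longrightarrow> G i \<in> borel_measurable (PiM I M)"
    and "\<And>i x. i \<in> I \<Longrightarrow> x \<in> space (PiM I M) \<Longrightarrow> \<bar>G i x\<bar> \<le> B'"
    and "\<And>i x. i \<in> I \<Longrightarrow> x \<in> space (PiM I M) \<Longrightarrow>
           (\<integral>y. (f (x(i := y)))\<^sup>2 \<partial>M i) - (\<integral>y. f (x(i := y)) \<partial>M i)\<^sup>2 \<le> (\<integral>y. G i (x(i := y)) \<partial>M i)"
  shows "(\<integral>x. (f x)\<^sup>2 \<partial>PiM I M) - (\<integral>x. f x \<partial>PiM I M)\<^sup>2 \<le> (\<Sum>i\<in>I. \<integral>x. G i x \<partial>PiM I M)"
  using assms
proof (induction I arbitrary: f G rule: finite_induct)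
  case empty
  show ?case by (simp add: PiM_empty lebesgue_integral_count_space_finite)
next
  case (insert j I)
  note prob = insert.prems(1) and f = insert.prems(2) and fB = insert.prems(3)
    and G = insert.prems(4) and GB = insert.prems(5) and slice = insert.prems(6)
  let ?P = "PiM I M" and ?Q = "PiM (insert j I) M" and ?R = "M j \<Otimes>\<^sub>M PiM I M"
  interpret M1: prob_space "M j" using prob by simp
  interpret M2: prob_space ?P using prob by (intro prob_space_PiM) simp
  interpret R: pair_prob_space "M j" ?P by unfold_locales
  let ?h = "\<lambda>(y, x). x(j := y)"
  have h [measurable]: "?h \<in> measurable ?R ?Q" by measurable
  have distr: "distr ?R ?Q ?h = ?Q" using prob by (intro distr_pair_PiM_eq_PiM) auto
  have h_space: "x(j := y) \<in> space ?Q" if "y \<in> space (M j)" "x \<in> space ?P" for x y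
    using measurable_space[OF h, of "(y, x)"] that by (simp add: space_pair_measure)
  have slice_j: "(\<lambda>x. x(j := y)) \<in> measurable ?P ?Q" if "y \<in> space (M j)" for y
    using measurable_compose[OF measurable_Pair1'[OF that] h] by simp
  have to_pair: "(\<integral>x. g x \<partial>?Q) = (\<integral>z. g (?h z) \<partial>?R)" if "g \<in> borel_measurable ?Q" for g :: "_ \<Rightarrow> real"
    using integral_distr[OF h that] unfolding distr .
  define F where "F z = f (?h z)" for z
  have F [measurable]: "F \<in> borel_measurable ?R" unfolding F_def using measurable_compose[OF h f] .
  have FB: "\<bar>F z\<bar> \<le> B" if "z \<in> space ?R" for z
    unfolding F_def by (rule fB[OF measurable_space[OF h that]])
  have G_int: "integrable ?R (\<lambda>z. G i (?h z))" if "i \<in> insert j I" for i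
    using measurable_compose[OF h G[OF that]] GB[OF that measurable_space[OF h]]
    by (intro R.P.integrable_const_bound[where B = B']) auto
  have G_swap: "(\<integral>y. \<integral>x. G i (x(j := y)) \<partial>?P \<partial>M j) = (\<integral>x. G i x \<partial>?Q)" if "i \<in> insert j I" for i
    using R.integral_fst'[OF G_int[OF that]] to_pair[OF G[OF that]] by simp
  have G_swap': "(\<integral>x. \<integral>y. G i (x(j := y)) \<partial>M j \<partial>?P) = (\<integral>x. G i x \<partial>?Q)" if "i \<in> insert j I" for i
    using R.integral_snd[of "\<lambda>y x. G i (x(j := y))"] G_int[OF that] to_pair[OF G[OF that]]
    by (simp add: case_prod_unfold fun_upd_def)
  have G_fst_int: "integrable (M j) (\<lambda>y. \<integral>x. G i (x(j := y)) \<partial>?P)" if "i \<in> insert j I" for i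
    using R.integrable_fst'[OF G_int[OF that]] by simp
  have G_snd_int: "integrable ?P (\<lambda>x. \<integral>y. G i (x(j := y)) \<partial>M j)" if "i \<in> insert j I" for i
    using R.integrable_snd[of "\<lambda>y x. G i (x(j := y))"] G_int[OF that] by (simp add: case_prod_unfold)
  have F2_int: "integrable ?R (\<lambda>z. (F z)\<^sup>2)"
  proof (rule R.P.integrable_const_bound[where B = "B\<^sup>2"], rule AE_I2)
    fix z assume "z \<in> space ?R"
    from power_mono[OF FB[OF this] abs_ge_zero, of 2] show "norm ((F z)\<^sup>2) \<le> B\<^sup>2" by simp
  qed simp
  have F_abs: "\<bar>\<integral>x. F (y, x) \<partial>?P\<bar> \<le> B" if "y \<in> space (M j)" for y
  proof -
    have m: "(\<lambda>x. F (y, x)) \<in> borel_measurable ?P" using measurable_compose[OF measurable_Pair1'[OF that] F] .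
    then have "integrable ?P (\<lambda>x. F (y, x))"
      using that by (intro M2.integrable_const_bound[where B = B]) (auto simp: FB space_pair_measure)
    then have "(\<integral>x. \<bar>F (y, x)\<bar> \<partial>?P) \<le> (\<integral>x. B \<partial>?P)"
      using that by (intro integral_mono) (auto simp: FB space_pair_measure)
    from order_trans[OF integral_abs_bound this] show ?thesis by (simp add: M2.prob_space)
  qed
  have F_abs': "\<bar>\<integral>y. F (y, x) \<partial>M j\<bar> \<le> B" if "x \<in> space ?P" for x
  proof -
    have m: "(\<lambda>y. F (y, x)) \<in> borel_measurable (M j)" using measurable_compose[OF measurable_Pair2'[OF that] F] .
    then have "integrable (M j) (\<lambda>y. F (y, x))"
      using that by (intro M1.integrable_const_bound[where B = B]) (auto simp: FB space_pair_measure)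
    then have "(\<integral>y. \<bar>F (y, x)\<bar> \<partial>M j) \<le> (\<integral>y. B \<partial>M j)"
      using that by (intro integral_mono) (auto simp: FB space_pair_measure)
    from order_trans[OF integral_abs_bound this] show ?thesis by (simp add: M1.prob_space)
  qed
  have B0: "B \<ge> 0"
    using M1.not_empty F_abs by (meson abs_ge_zero equals0I order_trans)
  have mean1_int: "integrable (M j) (\<lambda>y. (\<integral>x. F (y, x) \<partial>?P)\<^sup>2)"
    using F_abs B0 by (intro M1.integrable_const_bound[where B = "B\<^sup>2"]) (auto simp: abs_le_square_iff[symmetric])
  have mean2_int: "integrable ?P (\<lambda>x. (\<integral>y. F (y, x) \<partial>M j)\<^sup>2)"
    using F_abs' B0 by (intro M2.integrable_const_bound[where B = "B\<^sup>2"]) (auto simp: abs_le_square_iff[symmetric])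
  have "(\<integral>x. (f x)\<^sup>2 \<partial>?Q) - (\<integral>x. f x \<partial>?Q)\<^sup>2 = (\<integral>z. (F z)\<^sup>2 \<partial>?R) - (\<integral>z. F z \<partial>?R)\<^sup>2"
    using f by (simp add: to_pair F_def)
  also have "\<dots> \<le> (\<integral>y. (\<integral>x. (F (y, x))\<^sup>2 \<partial>?P) - (\<integral>x. F (y, x) \<partial>?P)\<^sup>2 \<partial>M j)
      + (\<integral>x. (\<integral>y. (F (y, x))\<^sup>2 \<partial>M j) - (\<integral>y. F (y, x) \<partial>M j)\<^sup>2 \<partial>?P)"
    by (rule R.variance_le_sum_conditional[OF F FB])
  also have "\<dots> \<le> (\<integral>y. (\<Sum>i\<in>I. \<integral>x. G i (x(j := y)) \<partial>?P) \<partial>M j) + (\<integral>x. (\<integral>y. G j (x(j := y)) \<partial>M j) \<partial>?P)"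
  proof (intro add_mono integral_mono)
    fix y assume y: "y \<in> space (M j)"
    show "(\<integral>x. (F (y, x))\<^sup>2 \<partial>?P) - (\<integral>x. F (y, x) \<partial>?P)\<^sup>2 \<le> (\<Sum>i\<in>I. \<integral>x. G i (x(j := y)) \<partial>?P)"
      unfolding F_def prod.case
    proof (rule insert.IH)
      show "(\<lambda>x. f (x(j := y))) \<in> borel_measurable ?P" using measurable_compose[OF slice_j[OF y] f] .
      show "(\<lambda>x. G i (x(j := y))) \<in> borel_measurable ?P" if "i \<in> I" for i
        using measurable_compose[OF slice_j[OF y] G[of i]] that by (simp add: fun_upd_def)
      fix i x assume i: "i \<in> I" and x: "x \<in> space ?P"
      have twist: "x(i := z, j := y) = x(j := y, i := z)" for z
        using i \<open>j \<notin> I\<close> by (intro fun_upd_twist) auto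
      show "(\<integral>z. (f (x(i := z, j := y)))\<^sup>2 \<partial>M i) - (\<integral>z. f (x(i := z, j := y)) \<partial>M i)\<^sup>2
          \<le> (\<integral>z. G i (x(i := z, j := y)) \<partial>M i)"
        unfolding twist by (rule slice[OF _ h_space[OF y x]]) (use i in simp)
    next
      show "\<bar>f (x(j := y))\<bar> \<le> B" if "x \<in> space ?P" for x
        by (rule fB[OF h_space[OF y that]])
      show "\<bar>G i (x(j := y))\<bar> \<le> B'" if "i \<in> I" "x \<in> space ?P" for i x
        by (rule GB[OF insertI2[OF that(1)] h_space[OF y that(2)]])
    qed (use prob in simp)
  next
    fix x assume x: "x \<in> space ?P"
    \<comment> \<open>The hypothesis speaks of points of the full product; the value \<open>y0\<close> that completes \<open>x\<close> to one is
      overwritten at once.\<close>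
    obtain y0 where y0: "y0 \<in> space (M j)" using M1.not_empty by blast
    show "(\<integral>y. (F (y, x))\<^sup>2 \<partial>M j) - (\<integral>y. F (y, x) \<partial>M j)\<^sup>2 \<le> (\<integral>y. G j (x(j := y)) \<partial>M j)"
      unfolding F_def prod.case using slice[OF insertI1 h_space[OF y0 x]] by (simp only: fun_upd_upd)
  next
    show "integrable (M j) (\<lambda>y. (\<integral>x. (F (y, x))\<^sup>2 \<partial>?P) - (\<integral>x. F (y, x) \<partial>?P)\<^sup>2)"
      using R.integrable_fst'[OF F2_int] mean1_int by simp
    show "integrable ?P (\<lambda>x. (\<integral>y. (F (y, x))\<^sup>2 \<partial>M j) - (\<integral>y. F (y, x) \<partial>M j)\<^sup>2)"
      using R.integrable_snd[of "\<lambda>y x. (F (y, x))\<^sup>2"] F2_int mean2_int by (simp add: case_prod_unfold)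
  qed (use G_fst_int G_snd_int in auto)
  also have "\<dots> = (\<Sum>i\<in>insert j I. \<integral>x. G i x \<partial>?Q)"
    using G_fst_int G_swap G_swap' insert.hyps by simp
  finally show ?case .
qed

section \<open>The minimiser as a Lipschitz function of the data\<close>

lemma inner_Rn_Cauchy_Schwarz: "(inner_Rn p x y)\<^sup>2 \<le> inner_Rn p x x * inner_Rn p y y"
  unfolding inner_Rn_self unfolding inner_Rn_def by (rule Cauchy_Schwarz_ineq_sum)

text \<open>A single problem of fixed size, with explicit constants.  The constant \<open>lip\<close> derived below depends on
\<open>\<kappa>L\<close>, \<open>CL\<close>, \<open>\<kappa>\<close>, \<open>l0\<close> and \<open>r0\<close> alone, not on \<open>n\<close>, \<open>p\<close>, \<open>L\<close> or \<open>\<rho>\<close>, so fixing the five constants for a whole sequence of problems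
makes every bound uniform.\<close>

locale regularized_erm =
  fixes n p :: nat and L :: "real \<Rightarrow> real" and \<rho> :: "(nat \<Rightarrow> real) \<Rightarrow> real"
    and \<kappa>L CL \<kappa> l0 r0 :: real
  assumes n: "n \<ge> 1"
    and L_C1: "L C1_differentiable_on UNIV" and L'_C1: "deriv L C1_differentiable_on UNIV"
    and L'': "\<And>t. \<kappa>L \<le> deriv (deriv L) t" "\<And>t. deriv (deriv L) t \<le> CL" and \<kappa>L: "\<kappa>L > 0"
    and l0: "\<bar>deriv L 0\<bar> \<le> l0"
    and r0: "norm_Rn p (gradient p \<rho> (zero_Rn p)) \<le> r0"
    and \<rho>_C2: "C2_Rn p \<rho>"
    and \<rho>_convex: "\<And>\<theta>. \<theta> \<in> Rn p \<Longrightarrow> loewner_ge_scaled_id p (hessian \<rho> \<theta>) \<kappa>" and \<kappa>: "\<kappa> > 0"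
begin

abbreviation "L1 \<equiv> deriv L"
abbreviation "L2 \<equiv> deriv (deriv L)"

lemma L_deriv: "(L has_real_derivative L1 t) (at t)"
  using L_C1 by (simp add: C1_differentiable_on_eq DERIV_deriv_iff_real_differentiable)

lemma L1_deriv: "(L1 has_real_derivative L2 t) (at t)"
  using L'_C1 by (simp add: C1_differentiable_on_eq DERIV_deriv_iff_real_differentiable)

lemma L2_isCont: "isCont L2 t"
proof -
  obtain D where D: "\<And>t. (L1 has_vector_derivative D t) (at t)" "continuous_on UNIV D"
    using L'_C1 unfolding C1_differentiable_on_def by auto
  have "L2 = D"
    using D(1) by (auto simp: has_real_derivative_iff_has_vector_derivative[symmetric] intro!: DERIV_imp_deriv)
  then show ?thesis using D(2) by (simp add: continuous_on_eq_continuous_at)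
qed

lemma CL: "CL > 0"
  using L''[of 0] \<kappa>L by linarith

lemma L1_mean_value: "\<exists>m. \<kappa>L \<le> m \<and> m \<le> CL \<and> L1 s - L1 t = m * (s - t)"
  using mean_value_segment[OF L1_deriv, of t s] L'' by blast

lemma L_tangent: "L a \<ge> L 0 + L1 0 * a"
proof -
  obtain \<xi> where \<xi>: "\<xi> \<in> closed_segment 0 a" "L a - L 0 = L1 \<xi> * (a - 0)"
    using mean_value_segment[OF L_deriv, of 0 a] by blast
  obtain m where m: "m \<ge> \<kappa>L" "L1 \<xi> - L1 0 = m * (\<xi> - 0)" using L1_mean_value by blast
  have "L a - L 0 - L1 0 * a = m * (\<xi> * a)" using \<xi>(2) m(2) by (simp add: algebra_simps)
  also have "\<dots> \<ge> 0"
  proof (rule mult_nonneg_nonneg)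
    show "\<xi> * a \<ge> 0" using \<xi>(1)
      by (cases "0 \<le> a") (auto simp: closed_segment_eq_real_ivl intro: mult_nonpos_nonpos)
  qed (use m(1) \<kappa>L in simp)
  finally show ?thesis by simp
qed

text \<open>The one-dimensional analogue of the slopes of a continuously differentiable function on \<^term>\<open>Rn p\<close>.\<close>

lemma L1_slopes:
  assumes "(y \<longlongrightarrow> a) F"
  shows "\<exists>m. (\<forall>s. L1 (y s) - L1 a = m s * (y s - a)) \<and> (m \<longlongrightarrow> L2 a) F"
proof -
  have "\<forall>s. \<exists>\<xi>. \<xi> \<in> closed_segment a (y s) \<and> L1 (y s) - L1 a = L2 \<xi> * (y s - a)"
    using mean_value_segment[OF L1_deriv] by blast
  from choice[OF this] obtain \<xi> where
    \<xi>: "\<forall>s. \<xi> s \<in> closed_segment a (y s) \<and> L1 (y s) - L1 a = L2 (\<xi> s) * (y s - a)" ..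
  have "(\<xi> \<longlongrightarrow> a) F" by (rule tendsto_in_segment[OF assms]) (simp add: \<xi>)
  then have "((\<lambda>s. L2 (\<xi> s)) \<longlongrightarrow> L2 a) F" by (rule isCont_tendsto_compose[OF L2_isCont])
  then show ?thesis using \<xi> by (intro exI[of _ "\<lambda>s. L2 (\<xi> s)"]) simp
qed

text \<open>The tangent of \<open>L\<close> at 0 and the quadratic minorant of \<open>\<rho>\<close> at the origin bound the objective from below by a
quadratic function, whose linear part is absorbed into the quadratic part.\<close>

lemma minimizer_exists: "\<exists>\<theta>\<in>Rn p. \<forall>y\<in>Rn p. Psi n p x L \<rho> \<theta> \<le> Psi n p x L \<rho> y"
proof (rule coercive_attains_min)
  show "continuous_on (Rn p) (Psi n p x L \<rho>)"
  proof (rule continuous_on_RnI)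
    fix \<theta> :: "nat \<Rightarrow> real" and F
    assume \<theta>: "\<theta> \<in> Rn p" and ev: "eventually (\<lambda>y. y \<in> Rn p) F"
      and lim: "\<And>k. k < p \<Longrightarrow> ((\<lambda>y. y k) \<longlongrightarrow> \<theta> k) F"
    have "((\<lambda>y. inner_Rn p (x i) y) \<longlongrightarrow> inner_Rn p (x i) \<theta>) F" for i
      unfolding inner_Rn_def by (intro tendsto_intros lim) auto
    then have "((\<lambda>y. L (inner_Rn p (x i) y)) \<longlongrightarrow> L (inner_Rn p (x i) \<theta>)) F" for i
      by (rule isCont_tendsto_compose[OF DERIV_isCont[OF L_deriv]])
    moreover have "((\<lambda>y. \<rho> y) \<longlongrightarrow> \<rho> \<theta>) F"
      using \<rho>_C2 by (intro continuous_on_Rn_tendsto[OF _ \<theta> ev lim] C1_Rn_continuous) (auto simp: C2_Rn_def)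
    ultimately show "(Psi n p x L \<rho> \<longlongrightarrow> Psi n p x L \<rho> \<theta>) F"
      unfolding Psi_def by (intro tendsto_intros)
  qed
next
  define g where "g k = (1 / real n) * (\<Sum>i<n. L1 0 * x i k) + partial_deriv k \<rho> (zero_Rn p)" for k
  define b where "b = (\<Sum>k<p. (g k)\<^sup>2) / \<kappa> - L 0 - \<rho> (zero_Rn p)"
  fix \<theta> assume \<theta>: "\<theta> \<in> Rn p"
  have z: "zero_Rn p \<in> Rn p" by (simp add: zero_Rn_def Rn_restrict)
  have "- (\<Sum>k<p. g k * \<theta> k) = (\<Sum>k<p. \<theta> k * (- g k))" by (simp add: sum_negf mult.commute)
  also have "\<dots> \<le> (\<Sum>k<p. \<kappa> / 4 * (\<theta> k)\<^sup>2 + (- g k)\<^sup>2 / \<kappa>)"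
    by (intro sum_mono young_inequality \<kappa>)
  also have "\<dots> = \<kappa> / 4 * inner_Rn p \<theta> \<theta> + (\<Sum>k<p. (g k)\<^sup>2) / \<kappa>"
    by (simp add: sum.distrib inner_Rn_self sum_distrib_left sum_divide_distrib)
  finally have g: "- (\<Sum>k<p. g k * \<theta> k) \<le> \<dots>" .
  have "(\<Sum>i<n. L 0 + L1 0 * inner_Rn p (x i) \<theta>) \<le> (\<Sum>i<n. L (inner_Rn p (x i) \<theta>))"
    by (intro sum_mono L_tangent)
  then have "(1 / real n) * (\<Sum>i<n. L 0 + L1 0 * inner_Rn p (x i) \<theta>)
      \<le> (1 / real n) * (\<Sum>i<n. L (inner_Rn p (x i) \<theta>))"
    by (intro mult_left_mono) auto
  moreover have "(1 / real n) * (\<Sum>i<n. L 0 + L1 0 * inner_Rn p (x i) \<theta>)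
      = L 0 + (\<Sum>k<p. (1 / real n) * (\<Sum>i<n. L1 0 * x i k) * \<theta> k)"
  proof -
    have "(\<Sum>i<n. L1 0 * inner_Rn p (x i) \<theta>) = (\<Sum>k<p. (\<Sum>i<n. L1 0 * x i k) * \<theta> k)"
      unfolding inner_Rn_def sum_distrib_left sum_distrib_right by (subst sum.swap) (simp add: mult_ac)
    then show ?thesis using n
      by (simp add: sum.distrib sum_distrib_left[symmetric] sum_divide_distrib[symmetric] add_divide_distrib)
  qed
  ultimately have "L 0 + (\<Sum>k<p. (1 / real n) * (\<Sum>i<n. L1 0 * x i k) * \<theta> k)
      \<le> (1 / real n) * (\<Sum>i<n. L (inner_Rn p (x i) \<theta>))" by simp
  moreover have "\<rho> \<theta> \<ge> \<rho> (zero_Rn p) + (\<Sum>k<p. partial_deriv k \<rho> (zero_Rn p) * \<theta> k) + \<kappa> / 2 * inner_Rn p \<theta> \<theta>"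
    using strongly_convex_quadratic_minorant[OF z \<theta> \<rho>_C2 \<rho>_convex] by (simp add: zero_Rn_def inner_Rn_def)
  moreover have "(\<Sum>k<p. g k * \<theta> k) = (\<Sum>k<p. (1 / real n) * (\<Sum>i<n. L1 0 * x i k) * \<theta> k)
      + (\<Sum>k<p. partial_deriv k \<rho> (zero_Rn p) * \<theta> k)"
    by (simp add: g_def distrib_right sum.distrib)
  ultimately show "\<kappa> / 4 * inner_Rn p \<theta> \<theta> \<le> Psi n p x L \<rho> \<theta> + b"
    using g unfolding Psi_def b_def by linarith
qed (use \<kappa> in simp)

abbreviation \<theta>h :: "(nat \<Rightarrow> nat \<Rightarrow> real) \<Rightarrow> nat \<Rightarrow> real" where
  "\<theta>h x \<equiv> theta_hat n p x L \<rho>"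

abbreviation prediction :: "(nat \<Rightarrow> nat \<Rightarrow> real) \<Rightarrow> nat \<Rightarrow> real" where
  "prediction x i \<equiv> inner_Rn p (x i) (\<theta>h x)"

lemma theta_hat_minimizes:
  shows theta_hat_Rn: "\<theta>h x \<in> Rn p"
    and theta_hat_le: "y \<in> Rn p \<Longrightarrow> Psi n p x L \<rho> (\<theta>h x) \<le> Psi n p x L \<rho> y"
proof -
  have "\<exists>\<theta>. is_arg_min (Psi n p x L \<rho>) (\<lambda>y. y \<in> Rn p) \<theta>"
    using minimizer_exists[of x] by (auto simp: is_arg_min_linorder)
  then have "is_arg_min (Psi n p x L \<rho>) (\<lambda>y. y \<in> Rn p) (\<theta>h x)"
    unfolding theta_hat_def arg_min_on_def arg_min_def by (rule someI_ex)
  then show "\<theta>h x \<in> Rn p" "y \<in> Rn p \<Longrightarrow> Psi n p x L \<rho> (\<theta>h x) \<le> Psi n p x L \<rho> y"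
    by (auto simp: is_arg_min_linorder)
qed

lemma inner_Rn_upd: "k < p \<Longrightarrow> inner_Rn p v (\<theta>(k := t)) = inner_Rn p v \<theta> + v k * (t - \<theta> k)"
  unfolding inner_Rn_def by (simp add: sum.remove[of "{..<p}" k] algebra_simps)

lemma stationary_coord:
  assumes k: "k < p"
  shows "(1 / real n) * (\<Sum>i<n. L1 (prediction x i) * x i k) + partial_deriv k \<rho> (\<theta>h x) = 0"
proof (rule DERIV_local_min[where x = "\<theta>h x k" and d = 1])
  let ?P = "\<lambda>t. Psi n p x L \<rho> ((\<theta>h x)(k := t))"
  have "((\<lambda>t. L (inner_Rn p (x i) (\<theta>h x) + x i k * (t - \<theta>h x k))) has_real_derivative
      L1 (prediction x i) * x i k) (at (\<theta>h x k))" for i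
    by (rule DERIV_chain2[where f = L]) (auto intro!: derivative_eq_intros L_deriv)
  moreover have "((\<lambda>t. \<rho> ((\<theta>h x)(k := t))) has_real_derivative partial_deriv k \<rho> (\<theta>h x)) (at (\<theta>h x k))"
    using C1_Rn_partial[of p \<rho> "\<theta>h x" k "\<theta>h x k"] \<rho>_C2 theta_hat_Rn k by (simp add: C2_Rn_def)
  ultimately show "(?P has_real_derivative
      (1 / real n) * (\<Sum>i<n. L1 (prediction x i) * x i k) + partial_deriv k \<rho> (\<theta>h x)) (at (\<theta>h x k))"
    unfolding Psi_def inner_Rn_upd[OF k] by (intro DERIV_add DERIV_cmult DERIV_sum) auto
  show "\<forall>y. \<bar>\<theta>h x k - y\<bar> < 1 \<longrightarrow> ?P (\<theta>h x k) \<le> ?P y"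
    using theta_hat_le[OF Rn_upd[OF theta_hat_Rn k]] by simp
qed simp

text \<open>The vanishing gradient, tested against a direction \<open>v\<close>.\<close>

lemma stationary:
  "(1 / real n) * (\<Sum>i<n. L1 (prediction x i) * inner_Rn p (x i) v)
     + (\<Sum>k<p. partial_deriv k \<rho> (\<theta>h x) * v k) = 0"
proof -
  define s where "s k = (\<Sum>i<n. L1 (prediction x i) * x i k)" for k
  have "(\<Sum>i<n. L1 (prediction x i) * inner_Rn p (x i) v) = (\<Sum>k<p. s k * v k)"
    unfolding s_def inner_Rn_def[of p "x _" v] sum_distrib_left sum_distrib_right
    by (subst sum.swap) (simp add: mult_ac)
  then have "(1 / real n) * (\<Sum>i<n. L1 (prediction x i) * inner_Rn p (x i) v)
     + (\<Sum>k<p. partial_deriv k \<rho> (\<theta>h x) * v k)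
     = (\<Sum>k<p. ((1 / real n) * s k + partial_deriv k \<rho> (\<theta>h x)) * v k)"
    by (simp add: distrib_right sum.distrib sum_distrib_left mult.assoc)
  also have "\<dots> = (\<Sum>k<p. 0 * v k)"
    by (intro sum.cong refl arg_cong2[where f = "(*)"]) (use stationary_coord in \<open>simp add: s_def\<close>)
  finally show ?thesis by simp
qed

text \<open>The bound in the a priori estimate.  Its factor 2 covers the quarter of each square that is given up in
Young's inequality.\<close>

definition energy :: real where "energy = 2 * (l0\<^sup>2 / \<kappa>L + r0\<^sup>2 / \<kappa>)"

text \<open>Deterministic bounds, whatever the data: in the stationarity condition tested against the minimiser,
strong convexity of \<open>L\<close> and \<open>\<rho>\<close> produces the two squares on the left, and the slopes at 0 and at the origin
are absorbed by Young's inequality.\<close>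

lemma a_priori:
  "\<kappa>L * ((1 / real n) * (\<Sum>i<n. (prediction x i)\<^sup>2)) + \<kappa> * inner_Rn p (\<theta>h x) (\<theta>h x) \<le> energy"
proof -
  let ?a = "prediction x" and ?t = "\<theta>h x"
  define g where "g k = partial_deriv k \<rho> (zero_Rn p)" for k
  have z: "zero_Rn p \<in> Rn p" by (simp add: zero_Rn_def Rn_restrict)
  have "- (\<Sum>k<p. g k * ?t k) = (\<Sum>k<p. ?t k * (- g k))" by (simp add: sum_negf mult.commute)
  also have "\<dots> \<le> (\<Sum>k<p. \<kappa> / 4 * (?t k)\<^sup>2 + (- g k)\<^sup>2 / \<kappa>)"
    by (intro sum_mono young_inequality \<kappa>)
  also have "\<dots> = \<kappa> / 4 * inner_Rn p ?t ?t + inner_Rn p g g / \<kappa>"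
    by (simp add: sum.distrib inner_Rn_self sum_distrib_left sum_divide_distrib)
  also have "inner_Rn p g g \<le> r0\<^sup>2"
  proof -
    have "inner_Rn p g g = (norm_Rn p (gradient p \<rho> (zero_Rn p)))\<^sup>2"
      by (simp add: norm_Rn_sq gradient_def g_def inner_Rn_def)
    also have "\<dots> \<le> r0\<^sup>2" using r0 by (intro power_mono) (auto simp: L2_set_nonneg)
    finally show ?thesis .
  qed
  finally have g: "- (\<Sum>k<p. g k * ?t k) \<le> \<kappa> / 4 * inner_Rn p ?t ?t + r0\<^sup>2 / \<kappa>"
    using \<kappa> by (simp add: divide_right_mono)
  have \<rho>: "(\<Sum>k<p. partial_deriv k \<rho> ?t * ?t k) \<ge> (\<Sum>k<p. g k * ?t k) + \<kappa> * inner_Rn p ?t ?t"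
    using strongly_monotone_gradient[OF z theta_hat_Rn[of x] \<rho>_C2 \<rho>_convex]
    by (simp add: zero_Rn_def g_def inner_Rn_def left_diff_distrib sum_subtractf)
  have "L1 a * a \<ge> 3 / 4 * \<kappa>L * a\<^sup>2 - l0\<^sup>2 / \<kappa>L" for a
  proof -
    obtain m where m: "m \<ge> \<kappa>L" "L1 a - L1 0 = m * (a - 0)" using L1_mean_value by blast
    have "L1 a * a = m * a\<^sup>2 + L1 0 * a" using m(2) by (simp add: power2_eq_square algebra_simps)
    moreover have "m * a\<^sup>2 \<ge> \<kappa>L * a\<^sup>2" using m by (intro mult_right_mono) auto
    moreover have "a * (- L1 0) \<le> \<kappa>L / 4 * a\<^sup>2 + (- L1 0)\<^sup>2 / \<kappa>L" by (rule young_inequality[OF \<kappa>L])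
    moreover have "(- L1 0)\<^sup>2 / \<kappa>L \<le> l0\<^sup>2 / \<kappa>L"
      using l0 \<kappa>L abs_le_square_iff[of "L1 0" l0] by (intro divide_right_mono) auto
    ultimately show ?thesis by (simp add: mult.commute)
  qed
  then have "(1 / real n) * (\<Sum>i<n. L1 (?a i) * ?a i) \<ge> (1 / real n) * (\<Sum>i<n. 3 / 4 * \<kappa>L * (?a i)\<^sup>2 - l0\<^sup>2 / \<kappa>L)"
    by (intro mult_left_mono sum_mono) auto
  also have "(1 / real n) * (\<Sum>i<n. 3 / 4 * \<kappa>L * (?a i)\<^sup>2 - l0\<^sup>2 / \<kappa>L)
      = 3 / 4 * (\<kappa>L * ((1 / real n) * (\<Sum>i<n. (?a i)\<^sup>2))) - l0\<^sup>2 / \<kappa>L"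
  proof -
    have "(\<Sum>i<n. 3 / 4 * \<kappa>L * (?a i)\<^sup>2 - l0\<^sup>2 / \<kappa>L) = 3 / 4 * \<kappa>L * (\<Sum>i<n. (?a i)\<^sup>2) - real n * (l0\<^sup>2 / \<kappa>L)"
      by (simp add: sum_subtractf sum_distrib_left)
    then show ?thesis using n by (simp only: right_diff_distrib) simp
  qed
  finally have bal: "3 / 4 * (\<kappa>L * ((1 / real n) * (\<Sum>i<n. (?a i)\<^sup>2))) - l0\<^sup>2 / \<kappa>L + (\<Sum>k<p. partial_deriv k \<rho> ?t * ?t k) \<le> 0"
    using stationary[of x ?t] by simp
  have nonneg: "\<kappa>L * ((1 / real n) * (\<Sum>i<n. (?a i)\<^sup>2)) \<ge> 0" "\<kappa> * inner_Rn p ?t ?t \<ge> 0"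
    using \<kappa>L \<kappa> inner_Rn_self_nonneg[of p ?t] by (simp_all add: sum_nonneg)
  have "A + B \<le> 2 * (c1 + c2)"
    if "3 / 4 * A - c1 + R \<le> 0" "A \<ge> 0" "B \<ge> 0" "- G \<le> B / 4 + c2" "R \<ge> G + B"
    for A B G R c1 c2 :: real
    using that by argo
  moreover have "- (\<Sum>k<p. g k * ?t k) \<le> (\<kappa> * inner_Rn p ?t ?t) / 4 + r0\<^sup>2 / \<kappa>" using g by simp
  ultimately show ?thesis unfolding energy_def using bal nonneg \<rho> by blast
qed

lemma theta_hat_bounded: "inner_Rn p (\<theta>h x) (\<theta>h x) \<le> energy / \<kappa>"
proof -
  have "\<kappa>L * ((1 / real n) * (\<Sum>i<n. (prediction x i)\<^sup>2)) \<ge> 0"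
    using \<kappa>L by (intro mult_nonneg_nonneg sum_nonneg) auto
  then show ?thesis using a_priori[of x] \<kappa> by (simp add: field_simps)
qed

text \<open>An upper bound for the mean square of \<open>L'\<close> at the predictions; the added 1 makes it positive, since it
will be divided by.\<close>

definition loss_slope :: real where "loss_slope = 2 * l0\<^sup>2 + 2 * CL\<^sup>2 * (energy / \<kappa>L) + 1"

lemma mean_square_loss_slope: "(1 / real n) * (\<Sum>i<n. (L1 (prediction x i))\<^sup>2) \<le> loss_slope"
proof -
  have "(L1 a)\<^sup>2 \<le> 2 * l0\<^sup>2 + 2 * CL\<^sup>2 * a\<^sup>2" for a
  proof -
    obtain m where m: "m \<ge> \<kappa>L" "m \<le> CL" "L1 a - L1 0 = m * (a - 0)" using L1_mean_value by blast
    have "(L1 a)\<^sup>2 = (L1 0 + m * a)\<^sup>2" using m by (simp add: algebra_simps)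
    also have "\<dots> \<le> 2 * (L1 0)\<^sup>2 + 2 * (m * a)\<^sup>2"
      using zero_le_power2[of "L1 0 - m * a"] by (simp add: power2_eq_square algebra_simps)
    also have "(m * a)\<^sup>2 \<le> CL\<^sup>2 * a\<^sup>2"
      using m \<kappa>L unfolding power_mult_distrib by (intro mult_right_mono power_mono) auto
    also have "(L1 0)\<^sup>2 \<le> l0\<^sup>2" using l0 abs_le_square_iff[of "L1 0" l0] by simp
    finally show ?thesis by simp
  qed
  then have "(1 / real n) * (\<Sum>i<n. (L1 (prediction x i))\<^sup>2) \<le> (1 / real n) * (\<Sum>i<n. 2 * l0\<^sup>2 + 2 * CL\<^sup>2 * (prediction x i)\<^sup>2)"
    by (intro mult_left_mono sum_mono) auto
  also have "\<dots> = 2 * l0\<^sup>2 + 2 * CL\<^sup>2 * ((1 / real n) * (\<Sum>i<n. (prediction x i)\<^sup>2))"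
    using n by (simp add: sum.distrib sum_distrib_left[symmetric] field_simps)
  also have "(1 / real n) * (\<Sum>i<n. (prediction x i)\<^sup>2) \<le> energy / \<kappa>L"
  proof -
    have "\<kappa> * inner_Rn p (\<theta>h x) (\<theta>h x) \<ge> 0" using \<kappa> inner_Rn_self_nonneg by simp
    then have "\<kappa>L * ((1 / real n) * (\<Sum>i<n. (prediction x i)\<^sup>2)) \<le> energy" using a_priori[of x] by linarith
    then show ?thesis using \<kappa>L by (simp add: field_simps)
  qed
  finally show ?thesis by (simp add: loss_slope_def mult_left_mono)
qed

lemma loss_slope_pos: "loss_slope > 0"
proof -
  have "energy \<ge> 0" using \<kappa>L \<kappa> by (simp add: energy_def)
  then show ?thesis using \<kappa>L by (auto simp: loss_slope_def intro!: add_nonneg_pos add_nonneg_nonneg)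
qed

text \<open>\<open>lip / n\<close> bounds the square of the Lipschitz constant of the minimiser as a function of the data, for the
Euclidean (Frobenius) norm on \<open>n\<times>p\<close> matrices.\<close>

definition lip :: real where
  "lip = 2 / \<kappa> * (CL / 4 * (energy / \<kappa>) + loss_slope / (2 * \<kappa>))"

lemma lip_nonneg: "lip \<ge> 0"
  using \<kappa> \<kappa>L CL loss_slope_pos by (auto simp: lip_def energy_def intro!: mult_nonneg_nonneg add_nonneg_nonneg)

text \<open>The heart of the proof: the minimiser is a globally Lipschitz function of the whole data matrix, with
squared constant \<open>lip / n\<close>.  Subtract the stationarity conditions for \<open>x\<close> and \<open>x'\<close>, tested against the difference
\<open>\<delta>\<close> of the minimisers.  The increments of \<open>\<nabla>\<rho>\<close> yield \<open>\<kappa> |\<delta>|\<^sup>2\<close> and those of \<open>L'\<close> yield \<open>m\<^sub>i (a'\<^sub>i - a\<^sub>i)\<^sup>2\<close> with \<open>m\<^sub>i \<le> CL\<close>, where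
\<open>a\<^sub>i\<close>, \<open>a'\<^sub>i\<close> are the predictions.  The perturbation \<open>D\<^sub>i\<close> of a column enters through \<open>\<langle>D\<^sub>i, \<theta>\<rangle>\<close>, multiplied by
\<open>m\<^sub>i (a'\<^sub>i - a\<^sub>i)\<close> and controlled by the bound on \<open>|\<theta>|\<close>, and through \<open>\<langle>D\<^sub>i, \<delta>\<rangle>\<close>, multiplied by \<open>L'(a\<^sub>i)\<close> and controlled by the
bound on the mean square of \<open>L'(a\<^sub>i)\<close>.  The estimate is uniform in \<open>x\<close> and \<open>x'\<close> because the columns
occur only through predictions and their increments.\<close>

lemma theta_hat_Lipschitz:
  fixes x x' :: "nat \<Rightarrow> nat \<Rightarrow> real"
  defines "\<delta> \<equiv> \<lambda>k. \<theta>h x' k - \<theta>h x k" and "D \<equiv> \<lambda>i k. x' i k - x i k"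
  shows "inner_Rn p \<delta> \<delta> \<le> lip / real n * (\<Sum>i<n. inner_Rn p (D i) (D i))"
proof (cases "inner_Rn p \<delta> \<delta> = 0")
  case True
  then show ?thesis using lip_nonneg by (simp add: sum_nonneg inner_Rn_self_nonneg)
next
  case False
  define N where "N = inner_Rn p \<delta> \<delta>"
  have N: "N > 0" using False inner_Rn_self_nonneg[of p \<delta>] by (simp add: N_def)
  \<comment> \<open>With this weight in Young's inequality, averaging over \<open>i\<close> costs exactly half of \<open>\<kappa> |\<delta>|\<^sup>2\<close>.\<close>
  define \<eta> where "\<eta> = \<kappa> / (2 * loss_slope)"
  have \<eta>: "\<eta> > 0" using \<kappa> loss_slope_pos by (simp add: \<eta>_def)
  let ?a = "prediction x" and ?a' = "prediction x'"
  define T where "T i = L1 (?a i) * inner_Rn p (x i) \<delta> - L1 (?a' i) * inner_Rn p (x' i) \<delta>" for i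
  have T: "T i \<le> CL / 4 * (energy / \<kappa>) * inner_Rn p (D i) (D i)
        + (\<eta> * N * (L1 (?a i))\<^sup>2 + inner_Rn p (D i) (D i) / (4 * \<eta>))" for i
  proof -
    define e where "e = inner_Rn p (D i) (\<theta>h x)"
    define g where "g = inner_Rn p (D i) \<delta>"
    obtain m where m: "\<kappa>L \<le> m" "m \<le> CL" "L1 (?a' i) - L1 (?a i) = m * (?a' i - ?a i)"
      using L1_mean_value by blast
    have \<delta>: "inner_Rn p (x' i) \<delta> = (?a' i - ?a i) - e" "inner_Rn p (x i) \<delta> = (?a' i - ?a i) - e - g"
      by (simp_all add: e_def g_def \<delta>_def D_def inner_Rn_def sum_subtractf[symmetric] algebra_simps)
    have "T i = - (L1 (?a' i) - L1 (?a i)) * (?a' i - ?a i) + (L1 (?a' i) - L1 (?a i)) * e - L1 (?a i) * g"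
      unfolding T_def \<delta> by (simp add: algebra_simps)
    also have "\<dots> = m * ((?a' i - ?a i) * e - (?a' i - ?a i)\<^sup>2) + L1 (?a i) * (- g)"
      unfolding m(3) by (simp add: algebra_simps power2_eq_square)
    finally have Ti: "T i = \<dots>" .
    have "m * ((?a' i - ?a i) * e - (?a' i - ?a i)\<^sup>2) \<le> m * (e\<^sup>2 / 4)"
      using young_inequality[of 4 "?a' i - ?a i" e] m(1) \<kappa>L by (intro mult_left_mono) auto
    also have "\<dots> \<le> CL * ((inner_Rn p (D i) (D i) * (energy / \<kappa>)) / 4)"
    proof (intro mult_mono m(2) divide_right_mono)
      have "e\<^sup>2 \<le> inner_Rn p (D i) (D i) * inner_Rn p (\<theta>h x) (\<theta>h x)"
        unfolding e_def by (rule inner_Rn_Cauchy_Schwarz)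
      also have "\<dots> \<le> inner_Rn p (D i) (D i) * (energy / \<kappa>)"
        by (intro mult_left_mono theta_hat_bounded inner_Rn_self_nonneg)
      finally show "e\<^sup>2 \<le> inner_Rn p (D i) (D i) * (energy / \<kappa>)" .
    qed (use CL in auto)
    finally have "m * ((?a' i - ?a i) * e - (?a' i - ?a i)\<^sup>2) \<le> CL * ((inner_Rn p (D i) (D i) * (energy / \<kappa>)) / 4)" .
    moreover have "L1 (?a i) * (- g) \<le> \<eta> * N * (L1 (?a i))\<^sup>2 + inner_Rn p (D i) (D i) / (4 * \<eta>)"
    proof -
      have "L1 (?a i) * (- g) \<le> 4 * \<eta> * N / 4 * (L1 (?a i))\<^sup>2 + (- g)\<^sup>2 / (4 * \<eta> * N)"
        using \<eta> N by (intro young_inequality) simp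
      moreover have "(- g)\<^sup>2 / (4 * \<eta> * N) \<le> inner_Rn p (D i) (D i) * N / (4 * \<eta> * N)"
        using \<eta> N inner_Rn_Cauchy_Schwarz[of p "D i" \<delta>] by (intro divide_right_mono) (auto simp: g_def N_def)
      ultimately show ?thesis using N by simp
    qed
    ultimately show ?thesis unfolding Ti by (simp add: mult_ac)
  qed
  have "\<kappa> * N \<le> (\<Sum>k<p. (partial_deriv k \<rho> (\<theta>h x') - partial_deriv k \<rho> (\<theta>h x)) * \<delta> k)"
    unfolding N_def \<delta>_def
    by (rule strongly_monotone_gradient[OF theta_hat_Rn theta_hat_Rn \<rho>_C2 \<rho>_convex])
  also have "\<dots> = (1 / real n) * (\<Sum>i<n. T i)"
    using stationary[of x \<delta>] stationary[of x' \<delta>]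
    by (simp add: T_def left_diff_distrib right_diff_distrib diff_divide_distrib sum_subtractf)
  also have "\<dots> \<le> (1 / real n) * (\<Sum>i<n. CL / 4 * (energy / \<kappa>) * inner_Rn p (D i) (D i)
        + (\<eta> * N * (L1 (?a i))\<^sup>2 + inner_Rn p (D i) (D i) / (4 * \<eta>)))"
    by (intro mult_left_mono sum_mono T) simp
  also have "\<dots> = (CL / 4 * (energy / \<kappa>) + 1 / (4 * \<eta>)) / real n * (\<Sum>i<n. inner_Rn p (D i) (D i))
        + \<eta> * N * ((1 / real n) * (\<Sum>i<n. (L1 (?a i))\<^sup>2))"
  proof -
    have "(\<Sum>i<n. c * d i + (b * u i + d i / e)) = (c + 1 / e) * (\<Sum>i<n. d i) + b * (\<Sum>i<n. u i)"
      for c b e :: real and d u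
      by (simp add: sum.distrib sum_distrib_left distrib_right sum_divide_distrib)
    note eq = this
    have "1 / r * (C * S + b * U) = C / r * S + b * (1 / r * U)" for C S b U r :: real
      by (simp add: add_divide_distrib)
    then show ?thesis unfolding eq .
  qed
  also have "\<dots> \<le> (CL / 4 * (energy / \<kappa>) + 1 / (4 * \<eta>)) / real n * (\<Sum>i<n. inner_Rn p (D i) (D i)) + \<eta> * N * loss_slope"
    using \<eta> N by (intro add_left_mono mult_left_mono mean_square_loss_slope) simp
  also have "\<eta> * N * loss_slope = \<kappa> * N / 2"
    using loss_slope_pos by (simp add: \<eta>_def)
  also have "1 / (4 * \<eta>) = loss_slope / (2 * \<kappa>)" by (simp add: \<eta>_def)
  finally have "\<kappa> * N / 2 \<le> (CL / 4 * (energy / \<kappa>) + loss_slope / (2 * \<kappa>)) / real n * (\<Sum>i<n. inner_Rn p (D i) (D i))"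
    by simp
  from mult_left_mono[OF this, of "2 / \<kappa>"] \<kappa>
  have "N \<le> 2 / \<kappa> * ((CL / 4 * (energy / \<kappa>) + loss_slope / (2 * \<kappa>)) / real n * (\<Sum>i<n. inner_Rn p (D i) (D i)))"
    by simp
  moreover have "2 / \<kappa> * (C / r * S) = 2 / \<kappa> * C / r * S" for C r S :: real by simp
  ultimately show ?thesis unfolding N_def lip_def by metis
qed

end

section \<open>Differentiability of the minimiser in the data\<close>

context regularized_erm begin

lemma theta_hat_tendsto:
  assumes "\<And>i k. i < n \<Longrightarrow> k < p \<Longrightarrow> ((\<lambda>a. x a i k) \<longlongrightarrow> x0 i k) F" and l: "l < p"
  shows "((\<lambda>a. \<theta>h (x a) l) \<longlongrightarrow> \<theta>h x0 l) F"
proof -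
  define B where "B a = lip / real n * (\<Sum>i<n. inner_Rn p (\<lambda>k. x a i k - x0 i k) (\<lambda>k. x a i k - x0 i k))" for a
  have "(B \<longlongrightarrow> lip / real n * (\<Sum>i<n. inner_Rn p (\<lambda>k. x0 i k - x0 i k) (\<lambda>k. x0 i k - x0 i k))) F"
    unfolding B_def inner_Rn_def by (intro tendsto_mult tendsto_sum tendsto_diff tendsto_const assms) auto
  then have "((\<lambda>a. sqrt (B a)) \<longlongrightarrow> sqrt 0) F"
    by (intro tendsto_real_sqrt) (simp add: inner_Rn_def)
  then have B0: "((\<lambda>a. sqrt (B a)) \<longlongrightarrow> 0) F" by simp
  have "norm (\<theta>h (x a) l - \<theta>h x0 l) \<le> sqrt (B a)" for a
  proof -
    have "(\<theta>h (x a) l - \<theta>h x0 l)\<^sup>2 \<le> inner_Rn p (\<lambda>k. \<theta>h (x a) k - \<theta>h x0 k) (\<lambda>k. \<theta>h (x a) k - \<theta>h x0 k)"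
      unfolding inner_Rn_self using l by (intro member_le_sum) auto
    also have "\<dots> \<le> B a" unfolding B_def by (rule theta_hat_Lipschitz)
    finally show ?thesis using real_le_rsqrt[of "\<bar>\<theta>h (x a) l - \<theta>h x0 l\<bar>" "B a"] by simp
  qed
  then have "((\<lambda>a. \<theta>h (x a) l - \<theta>h x0 l) \<longlongrightarrow> 0) F"
    by (intro Lim_null_comparison[OF always_eventually B0]) blast
  then show ?thesis by (simp only: Lim_null[of "\<lambda>a. \<theta>h (x a) l" "\<theta>h x0 l"])
qed

text \<open>Differentiating the stationarity condition along a perturbation \<open>x + t V\<close> of the data gives the linear
system \<open>objective_hessian x \<cdot> w = forcing x V\<close> for the derivative \<open>w\<close> of the minimiser.\<close>

definition objective_hessian :: "(nat \<Rightarrow> nat \<Rightarrow> real) \<Rightarrow> nat \<Rightarrow> nat \<Rightarrow> real" where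
  "objective_hessian x k l =
     (1 / real n) * (\<Sum>i<n. L2 (prediction x i) * x i k * x i l) + hessian \<rho> (\<theta>h x) l k"

definition forcing :: "(nat \<Rightarrow> nat \<Rightarrow> real) \<Rightarrow> (nat \<Rightarrow> nat \<Rightarrow> real) \<Rightarrow> nat \<Rightarrow> real" where
  "forcing x V k = - (1 / real n) *
     (\<Sum>i<n. L2 (prediction x i) * x i k * inner_Rn p (V i) (\<theta>h x) + L1 (prediction x i) * V i k)"

lemma objective_hessian_coercive: "loewner_ge_scaled_id p (objective_hessian x) \<kappa>"
  unfolding loewner_ge_scaled_id_def
proof
  fix v
  have "(\<Sum>k<p. \<Sum>l<p. v k * objective_hessian x k l * v l)
      = (1 / real n) * (\<Sum>k<p. \<Sum>l<p. \<Sum>i<n. v k * (L2 (prediction x i) * x i k * x i l) * v l)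
        + (\<Sum>k<p. \<Sum>l<p. v k * hessian \<rho> (\<theta>h x) l k * v l)"
    by (simp add: objective_hessian_def distrib_left distrib_right sum.distrib sum_distrib_left sum_distrib_right
        sum_divide_distrib)
  also have "(\<Sum>k<p. \<Sum>l<p. \<Sum>i<n. v k * (L2 (prediction x i) * x i k * x i l) * v l)
      = (\<Sum>i<n. L2 (prediction x i) * (inner_Rn p (x i) v)\<^sup>2)"
  proof -
    have "(\<Sum>k<p. \<Sum>l<p. \<Sum>i<n. v k * (L2 (prediction x i) * x i k * x i l) * v l)
        = (\<Sum>i<n. \<Sum>k<p. \<Sum>l<p. v k * (L2 (prediction x i) * x i k * x i l) * v l)"
      by (subst sum.swap, subst (2) sum.swap) (rule refl)
    also have "\<dots> = (\<Sum>i<n. L2 (prediction x i) * (inner_Rn p (x i) v)\<^sup>2)"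
      unfolding power2_eq_square inner_Rn_def[of p "x _" v] sum_product
      unfolding sum_distrib_left by (intro sum.cong refl) (simp add: mult_ac)
    finally show ?thesis .
  qed
  also have "(\<Sum>k<p. \<Sum>l<p. v k * hessian \<rho> (\<theta>h x) l k * v l) = (\<Sum>k<p. \<Sum>l<p. v k * hessian \<rho> (\<theta>h x) k l * v l)"
    by (subst sum.swap) (simp add: mult_ac)
  finally have eq: "(\<Sum>k<p. \<Sum>l<p. v k * objective_hessian x k l * v l)
      = (1 / real n) * (\<Sum>i<n. L2 (prediction x i) * (inner_Rn p (x i) v)\<^sup>2) + \<dots>" .
  have "(1 / real n) * (\<Sum>i<n. L2 (prediction x i) * (inner_Rn p (x i) v)\<^sup>2) \<ge> 0"
    using L''(1) \<kappa>L by (intro mult_nonneg_nonneg sum_nonneg) (auto intro: order_trans[of 0 \<kappa>L])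
  moreover have "\<kappa> * inner_Rn p v v \<le> (\<Sum>k<p. \<Sum>l<p. v k * hessian \<rho> (\<theta>h x) k l * v l)"
    by (rule loewner_ge_scaled_idD[OF \<rho>_convex[OF theta_hat_Rn]])
  ultimately show "\<kappa> * inner_Rn p v v \<le> (\<Sum>k<p. \<Sum>l<p. v k * objective_hessian x k l * v l)"
    unfolding eq by linarith
qed

definition along :: "(nat \<Rightarrow> nat \<Rightarrow> real) \<Rightarrow> (nat \<Rightarrow> nat \<Rightarrow> real) \<Rightarrow> real \<Rightarrow> nat \<Rightarrow> nat \<Rightarrow> real" where
  "along x V t i k = x i k + t * V i k"

lemma along_0 [simp]: "along x V 0 = x"
  by (simp add: along_def fun_eq_iff)

text \<open>An implicit function theorem for the stationarity condition, with existence of the derivative obtained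
from stability of linear systems.  The difference quotient \<open>q t\<close> of the minimiser is bounded by the Lipschitz
estimate, and it solves a system whose coefficients are slopes of \<open>L'\<close> and \<open>\<nabla>\<rho>\<close>; these converge to the
Hessian of the objective and to the forcing term.  The bound on \<open>w\<close> is the Lipschitz estimate in the limit.\<close>

lemma theta_hat_directional_derivative_exists:
  "\<exists>w. (\<forall>k<p. (\<Sum>l<p. objective_hessian x k l * w l) = forcing x V k) \<and>
       (\<forall>k<p. ((\<lambda>t. \<theta>h (along x V t) k) has_real_derivative w k) (at 0)) \<and>
       inner_Rn p w w \<le> lip / real n * (\<Sum>i<n. inner_Rn p (V i) (V i))"
proof -
  let ?\<theta> = "\<theta>h x" and ?\<theta>t = "\<lambda>t. \<theta>h (along x V t)"
  let ?a = "prediction x" and ?at = "\<lambda>t. prediction (along x V t)"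
  define q where "q t l = (?\<theta>t t l - ?\<theta> l) / t" for t l
  define K2 where "K2 = lip / real n * (\<Sum>i<n. inner_Rn p (V i) (V i))"
  have xt: "((\<lambda>t. along x V t i k) \<longlongrightarrow> x i k) (at 0)" for i k
    unfolding along_def by (auto intro!: tendsto_eq_intros)
  have \<theta>t: "((\<lambda>t. ?\<theta>t t l) \<longlongrightarrow> ?\<theta> l) (at 0)" if "l < p" for l
    by (rule theta_hat_tendsto[OF xt that])
  have at_lim: "((\<lambda>t. ?at t i) \<longlongrightarrow> ?a i) (at 0)" for i
    unfolding inner_Rn_def by (intro tendsto_sum tendsto_mult xt \<theta>t) auto
  have q_le: "inner_Rn p (q t) (q t) \<le> K2" if "t \<noteq> 0" for t
  proof -
    have "inner_Rn p (q t) (q t) = inner_Rn p (\<lambda>k. ?\<theta>t t k - ?\<theta> k) (\<lambda>k. ?\<theta>t t k - ?\<theta> k) / t\<^sup>2"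
      by (simp add: q_def inner_Rn_self power_divide sum_divide_distrib)
    also have "\<dots> \<le> (lip / real n * (\<Sum>i<n. inner_Rn p (\<lambda>k. along x V t i k - x i k) (\<lambda>k. along x V t i k - x i k))) / t\<^sup>2"
      by (intro divide_right_mono theta_hat_Lipschitz) simp
    also have "\<dots> = K2" using that
      by (simp add: along_def K2_def inner_Rn_self power_mult_distrib sum_distrib_left[symmetric])
    finally show ?thesis .
  qed
  have K: "eventually (\<lambda>t. \<forall>k<p. \<bar>q t k\<bar> \<le> sqrt K2) (at 0)"
  proof (unfold eventually_at_filter, intro always_eventually allI impI)
    fix t k assume "t \<noteq> (0::real)" "k < p"
    then have "(q t k)\<^sup>2 \<le> inner_Rn p (q t) (q t)"
      unfolding inner_Rn_self by (intro member_le_sum) auto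
    then show "\<bar>q t k\<bar> \<le> sqrt K2" using q_le[OF \<open>t \<noteq> 0\<close>] by (intro real_le_rsqrt) simp
  qed
  have "\<forall>i. \<exists>m. (\<forall>t. L1 (?at t i) - L1 (?a i) = m t * (?at t i - ?a i)) \<and> (m \<longlongrightarrow> L2 (?a i)) (at 0)"
    using L1_slopes[OF at_lim] by blast
  from choice[OF this] obtain m where
    m_all: "\<forall>i. (\<forall>t. L1 (?at t i) - L1 (?a i) = m i t * (?at t i - ?a i)) \<and> (m i \<longlongrightarrow> L2 (?a i)) (at 0)" ..
  have m: "L1 (?at t i) - L1 (?a i) = m i t * (?at t i - ?a i)"
    and m_lim: "(m i \<longlongrightarrow> L2 (?a i)) (at 0)" for i t
    using m_all by blast+
  define is_slope where "is_slope k S \<longleftrightarrow>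
      eventually (\<lambda>t. partial_deriv k \<rho> (?\<theta>t t) - partial_deriv k \<rho> ?\<theta> = (\<Sum>l<p. S l t * (?\<theta>t t l - ?\<theta> l))) (at 0) \<and>
      (\<forall>l<p. (S l \<longlongrightarrow> partial_deriv l (partial_deriv k \<rho>) ?\<theta>) (at 0))" for k S
  have "\<forall>k\<in>{..<p}. \<exists>S. is_slope k S"
    unfolding is_slope_def using \<rho>_C2
    by (intro ballI C1_Rn_slopes theta_hat_Rn \<theta>t always_eventually allI) (auto simp: C2_Rn_def)
  from bchoice[OF this] obtain S where S_all: "\<forall>k\<in>{..<p}. is_slope k (S k)" ..
  then have S: "eventually (\<lambda>t. partial_deriv k \<rho> (?\<theta>t t) - partial_deriv k \<rho> ?\<theta>
                 = (\<Sum>l<p. S k l t * (?\<theta>t t l - ?\<theta> l))) (at 0)"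
    and S_lim: "l < p \<Longrightarrow> (S k l \<longlongrightarrow> hessian \<rho> ?\<theta> l k) (at 0)" if "k < p" for k l
    using that unfolding is_slope_def hessian_def by blast+
  define A where "A t k l = (1 / real n) * (\<Sum>i<n. m i t * x i k * x i l) + S k l t" for t k l
  define b where "b t k = - (1 / real n) *
     (\<Sum>i<n. m i t * x i k * inner_Rn p (V i) (?\<theta>t t) + L1 (?at t i) * V i k)" for t k
  have eq_k: "eventually (\<lambda>t. (\<Sum>l<p. A t k l * q t l) = b t k) (at 0)" if k: "k < p" for k
  proof -
    have ne: "eventually (\<lambda>t. t \<noteq> 0) (at (0::real))" by (auto simp: eventually_at_filter)
    show ?thesis
      using S[OF k] ne
    proof eventually_elim
      case (elim t)
      define dS where "dS = (\<Sum>l<p. S k l t * (?\<theta>t t l - ?\<theta> l))"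
      have pr: "?at t i - ?a i = (\<Sum>l<p. x i l * (?\<theta>t t l - ?\<theta> l)) + t * inner_Rn p (V i) (?\<theta>t t)" for i
        by (simp add: inner_Rn_def along_def sum_distrib_left sum_subtractf[symmetric] sum.distrib[symmetric] algebra_simps)
      have "L1 (?at t i) * along x V t i k - L1 (?a i) * x i k
          = (\<Sum>l<p. m i t * x i k * x i l * (?\<theta>t t l - ?\<theta> l))
            + t * (m i t * x i k * inner_Rn p (V i) (?\<theta>t t) + L1 (?at t i) * V i k)" for i
      proof -
        have "L1 (?at t i) * along x V t i k - L1 (?a i) * x i k
            = (L1 (?at t i) - L1 (?a i)) * x i k + t * (L1 (?at t i) * V i k)"
          by (simp add: along_def algebra_simps)
        also have "(L1 (?at t i) - L1 (?a i)) * x i k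
            = m i t * ((\<Sum>l<p. x i l * (?\<theta>t t l - ?\<theta> l)) + t * inner_Rn p (V i) (?\<theta>t t)) * x i k"
          unfolding m pr ..
        also have "\<dots> = (\<Sum>l<p. m i t * x i k * x i l * (?\<theta>t t l - ?\<theta> l)) + t * (m i t * x i k * inner_Rn p (V i) (?\<theta>t t))"
          by (simp add: distrib_left distrib_right sum_distrib_left sum_distrib_right mult_ac)
        finally show ?thesis by (simp add: distrib_left)
      qed
      note incr = this
      have "0 = ((1 / real n) * (\<Sum>i<n. L1 (?at t i) * along x V t i k) + partial_deriv k \<rho> (?\<theta>t t))
          - ((1 / real n) * (\<Sum>i<n. L1 (?a i) * x i k) + partial_deriv k \<rho> ?\<theta>)"
        using stationary_coord[OF k, of x] stationary_coord[OF k, of "along x V t"] by simp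
      also have "\<dots> = (1 / real n) * (\<Sum>i<n. L1 (?at t i) * along x V t i k - L1 (?a i) * x i k)
          + (partial_deriv k \<rho> (?\<theta>t t) - partial_deriv k \<rho> ?\<theta>)"
        by (simp add: sum_subtractf diff_divide_distrib)
      also have "\<dots> = (1 / real n) * (\<Sum>i<n. \<Sum>l<p. m i t * x i k * x i l * (?\<theta>t t l - ?\<theta> l)) - t * b t k + dS"
        unfolding incr elim(1) dS_def[symmetric] b_def
        by (simp add: sum.distrib sum_distrib_left[symmetric] add_divide_distrib right_diff_distrib distrib_left)
      also have "(1 / real n) * (\<Sum>i<n. \<Sum>l<p. m i t * x i k * x i l * (?\<theta>t t l - ?\<theta> l))
          = (\<Sum>l<p. (1 / real n) * (\<Sum>i<n. m i t * x i k * x i l) * (?\<theta>t t l - ?\<theta> l))"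
        unfolding sum_distrib_left sum_distrib_right by (subst sum.swap) (simp add: mult_ac)
      finally have "t * b t k = (\<Sum>l<p. A t k l * (?\<theta>t t l - ?\<theta> l))"
        unfolding A_def dS_def distrib_right sum.distrib by linarith
      then show ?case using elim(2) by (simp add: q_def sum_divide_distrib[symmetric] field_simps)
    qed
  qed
  have "eventually (\<lambda>t. \<forall>k\<in>{..<p}. (\<Sum>l<p. A t k l * q t l) = b t k) (at 0)"
    using eq_k by (intro eventually_ball_finite) auto
  then have eq: "eventually (\<lambda>t. \<forall>k<p. (\<Sum>l<p. A t k l * q t l) = b t k) (at 0)"
    by (rule eventually_mono) simp
  have A_lim: "((\<lambda>t. A t k l) \<longlongrightarrow> objective_hessian x k l) (at 0)" if "k < p" "l < p" for k l
    unfolding A_def objective_hessian_def by (intro tendsto_intros m_lim S_lim that)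
  have "((\<lambda>t. L1 (?at t i)) \<longlongrightarrow> L1 (?a i)) (at 0)" for i
    by (rule isCont_tendsto_compose[OF DERIV_isCont[OF L1_deriv] at_lim])
  moreover have "((\<lambda>t. inner_Rn p (V i) (?\<theta>t t)) \<longlongrightarrow> inner_Rn p (V i) ?\<theta>) (at 0)" for i
    unfolding inner_Rn_def by (intro tendsto_sum tendsto_mult tendsto_const \<theta>t) auto
  ultimately have b_lim: "((\<lambda>t. b t k) \<longlongrightarrow> forcing x V k) (at 0)" for k
    unfolding b_def forcing_def by (intro tendsto_mult tendsto_sum tendsto_add tendsto_const m_lim)
  obtain w where w: "\<And>k. k < p \<Longrightarrow> (\<Sum>l<p. objective_hessian x k l * w l) = forcing x V k"
    using coercive_solvable[OF objective_hessian_coercive \<kappa>, of x "forcing x V"] by blast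
  have q_lim: "((\<lambda>t. q t l) \<longlongrightarrow> w l) (at 0)" if "l < p" for l
    by (rule coercive_solution_stable[OF objective_hessian_coercive \<kappa> eq A_lim b_lim K w that])
  have "((\<lambda>t. inner_Rn p (q t) (q t)) \<longlongrightarrow> inner_Rn p w w) (at 0)"
    unfolding inner_Rn_def by (intro tendsto_sum tendsto_mult q_lim) auto
  then have "inner_Rn p w w \<le> K2"
    by (rule tendsto_upperbound) (auto simp: eventually_at_filter q_le)
  moreover have "((\<lambda>t. ?\<theta>t t k) has_real_derivative w k) (at 0)" if "k < p" for k
    using q_lim[OF that] by (simp add: has_field_derivative_iff q_def)
  ultimately show ?thesis using w unfolding K2_def by blast
qed

definition dtheta :: "(nat \<Rightarrow> nat \<Rightarrow> real) \<Rightarrow> (nat \<Rightarrow> nat \<Rightarrow> real) \<Rightarrow> nat \<Rightarrow> real" where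
  "dtheta x V k = deriv (\<lambda>t. \<theta>h (along x V t) k) 0"

lemma dtheta_props:
  shows dtheta_has_derivative: "k < p \<Longrightarrow> ((\<lambda>t. \<theta>h (along x V t) k) has_real_derivative dtheta x V k) (at 0)"
    and dtheta_equation: "k < p \<Longrightarrow> (\<Sum>l<p. objective_hessian x k l * dtheta x V l) = forcing x V k"
    and dtheta_le: "inner_Rn p (dtheta x V) (dtheta x V) \<le> lip / real n * (\<Sum>i<n. inner_Rn p (V i) (V i))"
proof -
  obtain w where w: "\<And>k. k < p \<Longrightarrow> (\<Sum>l<p. objective_hessian x k l * w l) = forcing x V k"
    "\<And>k. k < p \<Longrightarrow> ((\<lambda>t. \<theta>h (along x V t) k) has_real_derivative w k) (at 0)"
    "inner_Rn p w w \<le> lip / real n * (\<Sum>i<n. inner_Rn p (V i) (V i))"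
    using theta_hat_directional_derivative_exists[of x V] by blast
  have d: "dtheta x V k = w k" if "k < p" for k
    unfolding dtheta_def by (rule DERIV_imp_deriv[OF w(2)[OF that]])
  show "k < p \<Longrightarrow> ((\<lambda>t. \<theta>h (along x V t) k) has_real_derivative dtheta x V k) (at 0)"
    "k < p \<Longrightarrow> (\<Sum>l<p. objective_hessian x k l * dtheta x V l) = forcing x V k"
    using w(1,2) by (simp_all add: d)
  show "inner_Rn p (dtheta x V) (dtheta x V) \<le> lip / real n * (\<Sum>i<n. inner_Rn p (V i) (V i))"
    using w(3) by (simp add: inner_Rn_def d)
qed

text \<open>The same stability argument, now along converging data, shows that the derivative depends continuously
on the data.\<close>

lemma dtheta_tendsto:
  assumes x: "\<And>i k. i < n \<Longrightarrow> k < p \<Longrightarrow> ((\<lambda>a. x a i k) \<longlongrightarrow> x0 i k) F" and l: "l < p"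
  shows "((\<lambda>a. dtheta (x a) V l) \<longlongrightarrow> dtheta x0 V l) F"
proof (rule coercive_solution_stable[OF objective_hessian_coercive \<kappa>])
  define K2 where "K2 = lip / real n * (\<Sum>i<n. inner_Rn p (V i) (V i))"
  have \<theta>: "((\<lambda>a. \<theta>h (x a) l) \<longlongrightarrow> \<theta>h x0 l) F" if "l < p" for l by (rule theta_hat_tendsto[OF x that])
  have pr: "((\<lambda>a. prediction (x a) i) \<longlongrightarrow> prediction x0 i) F" if "i < n" for i
    unfolding inner_Rn_def using that by (intro tendsto_sum tendsto_mult x \<theta>) auto
  have L1_lim: "((\<lambda>a. L1 (prediction (x a) i)) \<longlongrightarrow> L1 (prediction x0 i)) F" if "i < n" for i
    by (rule isCont_tendsto_compose[OF DERIV_isCont[OF L1_deriv] pr[OF that]])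
  have L2_lim: "((\<lambda>a. L2 (prediction (x a) i)) \<longlongrightarrow> L2 (prediction x0 i)) F" if "i < n" for i
    by (rule isCont_tendsto_compose[OF L2_isCont pr[OF that]])
  show "eventually (\<lambda>a. \<forall>k<p. (\<Sum>l<p. objective_hessian (x a) k l * dtheta (x a) V l) = forcing (x a) V k) F"
    by (simp add: dtheta_equation)
  show "((\<lambda>a. objective_hessian (x a) k l) \<longlongrightarrow> objective_hessian x0 k l) F" if "k < p" "l < p" for k l
  proof -
    have "((\<lambda>a. hessian \<rho> (\<theta>h (x a)) l k) \<longlongrightarrow> hessian \<rho> (\<theta>h x0) l k) F"
      unfolding hessian_def
      by (rule continuous_on_Rn_tendsto[OF _ theta_hat_Rn _ \<theta>])
         (use \<rho>_C2 that in \<open>auto simp: C2_Rn_def C1_Rn_def theta_hat_Rn\<close>)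
    then show ?thesis
      unfolding objective_hessian_def using that
      by (intro tendsto_add tendsto_mult tendsto_sum tendsto_const L2_lim x) auto
  qed
  show "((\<lambda>a. forcing (x a) V k) \<longlongrightarrow> forcing x0 V k) F" if "k < p" for k
  proof -
    have "((\<lambda>a. inner_Rn p (V i) (\<theta>h (x a))) \<longlongrightarrow> inner_Rn p (V i) (\<theta>h x0)) F" for i
      unfolding inner_Rn_def by (intro tendsto_sum tendsto_mult tendsto_const \<theta>) auto
    then show ?thesis
      unfolding forcing_def using that
      by (intro tendsto_add tendsto_mult tendsto_sum tendsto_const L2_lim L1_lim x) auto
  qed
  have "\<bar>dtheta (x a) V k\<bar> \<le> sqrt K2" if "k < p" for a k
  proof (rule real_le_rsqrt)
    have "(dtheta (x a) V k)\<^sup>2 \<le> inner_Rn p (dtheta (x a) V) (dtheta (x a) V)"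
      unfolding inner_Rn_self using that by (intro member_le_sum) auto
    also have "\<dots> \<le> K2" unfolding K2_def by (rule dtheta_le)
    finally show "\<bar>dtheta (x a) V k\<bar>\<^sup>2 \<le> K2" by simp
  qed
  then show "eventually (\<lambda>a. \<forall>k<p. \<bar>dtheta (x a) V k\<bar> \<le> sqrt K2) F" by simp
qed (use l dtheta_equation in auto)

definition unit_pert :: "nat \<Rightarrow> nat \<Rightarrow> nat \<Rightarrow> nat \<Rightarrow> real" where
  "unit_pert i j = (\<lambda>i' j'. if i' = i \<and> j' = j then 1 else 0)"

text \<open>The forcing term is linear in the perturbation and the system has a unique solution.  Linearity lets the
directional bound be applied to a perturbation that is itself a gradient.\<close>

lemma dtheta_linear:
  assumes k: "k < p"
  shows "dtheta x V k = (\<Sum>i<n. \<Sum>j<p. V i j * dtheta x (unit_pert i j) k)"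
proof (rule coercive_solution_unique[OF objective_hessian_coercive[of x] \<kappa> _ k])
  fix k assume k: "k < p"
  let ?c = "\<lambda>i. L2 (prediction x i) * x i k"
  have f_unit: "forcing x (unit_pert i j) k
      = - (1 / real n) * (?c i * \<theta>h x j + L1 (prediction x i) * (if k = j then 1 else 0))"
    if "i < n" "j < p" for i j
  proof -
    have in_unit: "inner_Rn p (unit_pert i j i') (\<theta>h x) = (if i' = i then \<theta>h x j else 0)" for i'
      using \<open>j < p\<close> by (cases "i' = i") (simp_all add: inner_Rn_def unit_pert_def if_distrib[of "\<lambda>u. u * _"] cong: if_cong)
    have "(\<Sum>i'<n. L2 (prediction x i') * x i' k * inner_Rn p (unit_pert i j i') (\<theta>h x) + L1 (prediction x i') * unit_pert i j i' k)
       = (\<Sum>i'<n. if i' = i then ?c i * \<theta>h x j + L1 (prediction x i) * (if k = j then 1 else 0) else 0)"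
      unfolding in_unit by (intro sum.cong refl) (simp add: unit_pert_def)
    then show ?thesis using \<open>i < n\<close> by (simp add: forcing_def)
  qed
  have "(\<Sum>l<p. objective_hessian x k l * (\<Sum>i<n. \<Sum>j<p. V i j * dtheta x (unit_pert i j) l))
      = (\<Sum>l<p. \<Sum>i<n. \<Sum>j<p. V i j * (objective_hessian x k l * dtheta x (unit_pert i j) l))"
    by (simp add: sum_distrib_left mult_ac)
  also have "\<dots> = (\<Sum>i<n. \<Sum>j<p. V i j * (\<Sum>l<p. objective_hessian x k l * dtheta x (unit_pert i j) l))"
    unfolding sum_distrib_left by (subst sum.swap, subst (2) sum.swap) (rule refl)
  also have "\<dots> = (\<Sum>i<n. \<Sum>j<p. V i j * forcing x (unit_pert i j) k)"
    using k by (simp add: dtheta_equation)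
  also have "\<dots> = (\<Sum>i<n. \<Sum>j<p. - (1 / real n) * (?c i * (V i j * \<theta>h x j)
        + L1 (prediction x i) * (if k = j then V i j else 0)))"
    by (intro sum.cong refl) (simp add: f_unit algebra_simps)
  also have "\<dots> = (\<Sum>i<n. - (1 / real n) * (?c i * inner_Rn p (V i) (\<theta>h x) + L1 (prediction x i) * V i k))"
    unfolding sum_distrib_left[symmetric] sum.distrib inner_Rn_def using k by simp
  also have "\<dots> = forcing x V k"
    unfolding forcing_def sum_distrib_left ..
  finally show "(\<Sum>l<p. objective_hessian x k l * dtheta x V l)
      = (\<Sum>l<p. objective_hessian x k l * (\<Sum>i<n. \<Sum>j<p. V i j * dtheta x (unit_pert i j) l))"
    using k by (simp add: dtheta_equation)
qed

text \<open>The partial derivative of \<open>f \<circ> \<theta>h\<close> with respect to entry \<open>j\<close> of column \<open>i\<close>, as given by the chain rule.\<close>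

definition data_partial :: "((nat \<Rightarrow> real) \<Rightarrow> real) \<Rightarrow> (nat \<Rightarrow> nat \<Rightarrow> real) \<Rightarrow> nat \<Rightarrow> nat \<Rightarrow> real" where
  "data_partial f x i j = (\<Sum>k<p. partial_deriv k f (\<theta>h x) * dtheta x (unit_pert i j) k)"

text \<open>With \<open>G\<close> the gradient of \<open>f \<circ> \<theta>h\<close> with respect to the data, \<open>|G|\<^sup>2\<close> is the derivative of \<open>f \<circ> \<theta>h\<close> in the direction
\<open>G\<close>, that is, \<open>\<langle>\<nabla>f, dtheta x G\<rangle> \<le> |\<nabla>f| (lip / n)\<^bsup>1/2\<^esup> |G|\<close>; cancel one factor \<open>|G|\<close>.\<close>

lemma data_gradient_le:
  "(\<Sum>i<n. \<Sum>j<p. (data_partial f x i j)\<^sup>2) \<le> lip / real n * (norm_Rn p (gradient p f (\<theta>h x)))\<^sup>2"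
proof -
  define G where "G = data_partial f x"
  define N where "N = (\<Sum>i<n. \<Sum>j<p. (G i j)\<^sup>2)"
  define g where "g k = partial_deriv k f (\<theta>h x)" for k
  have N0: "N \<ge> 0" by (simp add: N_def sum_nonneg)
  have g2: "(norm_Rn p (gradient p f (\<theta>h x)))\<^sup>2 = inner_Rn p g g"
    by (simp add: norm_Rn_sq gradient_def g_def inner_Rn_def)
  have "N = (\<Sum>i<n. \<Sum>j<p. \<Sum>k<p. g k * (G i j * dtheta x (unit_pert i j) k))"
    unfolding N_def power2_eq_square
    by (subst (2) G_def) (simp add: data_partial_def g_def sum_distrib_left mult_ac)
  also have "\<dots> = (\<Sum>k<p. \<Sum>i<n. \<Sum>j<p. g k * (G i j * dtheta x (unit_pert i j) k))"
    by (subst (2) sum.swap, subst sum.swap) (rule refl)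
  also have "\<dots> = inner_Rn p g (dtheta x G)"
    unfolding inner_Rn_def by (intro sum.cong refl) (simp add: dtheta_linear[of _ x G] sum_distrib_left)
  finally have "N\<^sup>2 \<le> inner_Rn p g g * inner_Rn p (dtheta x G) (dtheta x G)"
    using inner_Rn_Cauchy_Schwarz by metis
  also have "\<dots> \<le> inner_Rn p g g * (lip / real n * N)"
    using dtheta_le[of x G] by (intro mult_left_mono inner_Rn_self_nonneg) (simp add: N_def inner_Rn_self)
  finally have "N * N \<le> N * (lip / real n * inner_Rn p g g)" by (simp add: power2_eq_square mult_ac)
  moreover have "lip / real n * inner_Rn p g g \<ge> 0"
    using lip_nonneg inner_Rn_self_nonneg by simp
  ultimately have "N \<le> lip / real n * inner_Rn p g g"
    using N0 mult_le_cancel_left_pos[of N N "lip / real n * inner_Rn p g g"] by (cases "N = 0") linarith+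
  then show ?thesis by (simp add: g2 N_def G_def)
qed

lemma data_partial_deriv:
  assumes f: "C1_Rn p f" and "y \<in> Rn p" "i < n" "j < p"
  shows "((\<lambda>s. f (\<theta>h (x(i := y(j := s))))) has_real_derivative data_partial f (x(i := y)) i j) (at (y j))"
proof -
  have "((\<lambda>t. f (\<theta>h (along (x(i := y)) (unit_pert i j) t))) has_real_derivative
      (\<Sum>k<p. partial_deriv k f (\<theta>h (along (x(i := y)) (unit_pert i j) 0)) * dtheta (x(i := y)) (unit_pert i j) k)) (at 0)"
    by (intro C1_Rn_chain[OF f theta_hat_Rn] dtheta_has_derivative)
  then have "((\<lambda>t. f (\<theta>h (along (x(i := y)) (unit_pert i j) t))) has_real_derivative data_partial f (x(i := y)) i j) (at (y j - y j))"
    by (simp add: data_partial_def)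
  then have "((\<lambda>s. f (\<theta>h (along (x(i := y)) (unit_pert i j) (s - y j)))) has_real_derivative data_partial f (x(i := y)) i j) (at (y j))"
    using DERIV_shift[of "\<lambda>t. f (\<theta>h (along (x(i := y)) (unit_pert i j) t))" _ "y j" "- y j"] by simp
  moreover have "along (x(i := y)) (unit_pert i j) (s - y j) = x(i := y(j := s))" for s
    by (auto simp: along_def unit_pert_def fun_eq_iff)
  ultimately show ?thesis by simp
qed

lemma data_partial_tendsto:
  assumes f: "C1_Rn p f" and x: "\<And>i k. i < n \<Longrightarrow> k < p \<Longrightarrow> ((\<lambda>a. x a i k) \<longlongrightarrow> x0 i k) F"
  shows "((\<lambda>a. data_partial f (x a) i j) \<longlongrightarrow> data_partial f x0 i j) F"
  unfolding data_partial_def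
proof (intro tendsto_sum tendsto_mult dtheta_tendsto x)
  fix k assume "k \<in> {..<p}"
  then show "((\<lambda>a. partial_deriv k f (\<theta>h (x a))) \<longlongrightarrow> partial_deriv k f (\<theta>h x0)) F"
    using f by (intro continuous_on_Rn_tendsto[OF _ theta_hat_Rn _ theta_hat_tendsto] x)
      (auto simp: C1_Rn_def theta_hat_Rn)
qed auto

end

section \<open>From the gradient bound to the variance bound\<close>

text \<open>Bounded functions are square integrable, which brings \<^const>\<open>ext_variance\<close> into the form of the Efron--Stein inequality.\<close>

lemma ext_variance_bounded:
  assumes "prob_space M" and Y: "Y \<in> borel_measurable M" and B: "\<And>\<omega>. \<omega> \<in> space M \<Longrightarrow> \<bar>Y \<omega>\<bar> \<le> B"
  shows "ext_variance M Y = ennreal ((\<integral>\<omega>. (Y \<omega>)\<^sup>2 \<partial>M) - (\<integral>\<omega>. Y \<omega> \<partial>M)\<^sup>2)"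
proof -
  interpret prob_space M by fact
  note [measurable] = Y
  have int: "integrable M Y"
    by (rule integrable_const_bound[where B = B]) (auto intro!: AE_I2 simp: B)
  have int2: "integrable M (\<lambda>\<omega>. (Y \<omega>)\<^sup>2)"
  proof (rule integrable_const_bound[where B = "B\<^sup>2"], rule AE_I2)
    fix \<omega> assume "\<omega> \<in> space M"
    from power_mono[OF B[OF this] abs_ge_zero, of 2] show "norm ((Y \<omega>)\<^sup>2) \<le> B\<^sup>2" by simp
  qed simp
  have "integrable M (\<lambda>\<omega>. (Y \<omega>)\<^sup>2 - 2 * expectation Y * Y \<omega> + (expectation Y)\<^sup>2)"
    using int int2 by simp
  then have "integrable M (\<lambda>\<omega>. (Y \<omega> - expectation Y)\<^sup>2)"
    by (rule Bochner_Integration.integrable_cong[THEN iffD1, rotated 2])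
      (auto simp: power2_eq_square algebra_simps)
  then have "(\<integral>\<^sup>+\<omega>. ennreal ((Y \<omega> - expectation Y)\<^sup>2) \<partial>M) = ennreal (variance Y)"
    by (intro nn_integral_eq_integral) auto
  then show ?thesis using int variance_eq[OF int int2] by (simp add: ext_variance_def)
qed

text \<open>On the full function space the Borel sets of the product topology are generated by the countably many
coordinates, so a function that depends continuously on the entries of an \<open>n\<times>p\<close> matrix is Borel there; the
product of the column spaces embeds measurably, since all other coordinates are constant on it.\<close>

lemma borel_measurable_coordinatewise_continuous:
  fixes \<phi> :: "(nat \<Rightarrow> nat \<Rightarrow> real) \<Rightarrow> real"
  assumes "\<And>F x0. (\<And>i k. i < n \<Longrightarrow> k < p \<Longrightarrow> ((\<lambda>x. x i k) \<longlongrightarrow> x0 i k) F) \<Longrightarrow> (\<phi> \<longlongrightarrow> \<phi> x0) F"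
  shows "\<phi> \<in> borel_measurable (PiM {..<n} (\<lambda>_. borel_Rn p))"
proof -
  have coord: "continuous_on UNIV (\<lambda>x :: nat \<Rightarrow> nat \<Rightarrow> real. x i k)" for i k
    using continuous_on_compose2[OF continuous_on_product_coordinates[of k] continuous_on_product_coordinates[of i]]
    by simp
  have "continuous_on UNIV \<phi>"
    unfolding continuous_on_def
  proof
    fix x0
    show "(\<phi> \<longlongrightarrow> \<phi> x0) (at x0 within UNIV)"
      using coord unfolding continuous_on_def by (intro assms) blast
  qed
  then have \<phi>: "\<phi> \<in> borel_measurable borel" by (rule borel_measurable_continuous_onI)
  let ?P = "PiM {..<n} (\<lambda>_. borel_Rn p)"
  have "(\<lambda>x. x i k) \<in> borel_measurable ?P" for i k
  proof (cases "i < n")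
    case i: True
    then have comp: "(\<lambda>x. x i) \<in> measurable ?P (borel_Rn p)" by simp
    show ?thesis
    proof (cases "k < p")
      case True
      then have "(\<lambda>y. y k) \<in> measurable (borel_Rn p) (borel :: real measure)" by simp
      from measurable_compose[OF comp this] show ?thesis .
    next
      case False
      have "x i k = undefined" if "x \<in> space ?P" for x
        using measurable_space[OF comp that] False by (auto simp: space_PiM PiE_def extensional_def)
      then show ?thesis by (subst measurable_cong[where g = "\<lambda>_. undefined"]) auto
    qed
  next
    case False
    have "x i k = undefined k" if "x \<in> space ?P" for x
      using that False by (auto simp: space_PiM PiE_def extensional_def)
    then show ?thesis by (subst measurable_cong[where g = "\<lambda>_. undefined k"]) auto
  qed
  then have "(\<lambda>x. x) \<in> measurable ?P (borel :: (nat \<Rightarrow> nat \<Rightarrow> real) measure)"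
    by (intro measurable_coordinatewise_then_product)
  from measurable_compose[OF this \<phi>] show ?thesis .
qed

context regularized_erm begin

text \<open>Lets the data be taken in the product space of the first \<open>n\<close> columns.\<close>

lemma theta_hat_restrict: "\<theta>h (\<lambda>i\<in>{..<n}. x i) = \<theta>h x"
proof -
  have "Psi n p (\<lambda>i\<in>{..<n}. x i) L \<rho> = Psi n p x L \<rho>"
    by (simp add: Psi_def fun_eq_iff)
  then show ?thesis by (simp add: theta_hat_def)
qed

text \<open>The minimiser stays in a fixed compact cube, whatever the data.  Hence \<open>f\<close> and its gradient are bounded at
the minimiser, and all moments below are finite for arbitrary continuously differentiable \<open>f\<close>.\<close>

lemma bounded_at_theta_hat:
  assumes "continuous_on (Rn p) \<phi>"
  shows "\<exists>B::real. \<forall>x. \<bar>\<phi> (\<theta>h x)\<bar> \<le> B"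
proof -
  define R where "R = sqrt (energy / \<kappa>)"
  let ?B = "\<Pi>\<^sub>E j\<in>{..<p}. {-R..R}"
  have "?B \<subseteq> Rn p" by (auto simp: Rn_def PiE_def)
  then have "bounded (\<phi> ` ?B)"
    by (intro compact_imp_bounded compact_continuous_image continuous_on_subset[OF assms] compact_Rn_box)
  then obtain B where B: "\<And>\<theta>. \<theta> \<in> ?B \<Longrightarrow> \<bar>\<phi> \<theta>\<bar> \<le> B" by (auto simp: bounded_iff)
  have "\<theta>h x \<in> ?B" for x
  proof -
    have "\<bar>\<theta>h x k\<bar> \<le> R" if "k < p" for k
      unfolding R_def
    proof (rule real_le_rsqrt)
      have "(\<theta>h x k)\<^sup>2 \<le> inner_Rn p (\<theta>h x) (\<theta>h x)"
        unfolding inner_Rn_self using that by (intro member_le_sum) auto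
      then show "\<bar>\<theta>h x k\<bar>\<^sup>2 \<le> energy / \<kappa>" using theta_hat_bounded[of x] by simp
    qed
    then show ?thesis using theta_hat_Rn[of x] by (force simp: Rn_def PiE_def abs_le_iff)
  qed
  then show ?thesis using B by blast
qed

text \<open>The admissible test functions for the Poincare inequality of column \<open>i\<close>: all other columns are frozen.\<close>

lemma C1_Rn_one_column:
  fixes x :: "nat \<Rightarrow> nat \<Rightarrow> real"
  assumes f: "C1_Rn p f" and i: "i < n"
  defines "g \<equiv> \<lambda>y. f (\<theta>h (x(i := y)))"
  shows "C1_Rn p g"
    and "y \<in> Rn p \<Longrightarrow> (norm_Rn p (gradient p g y))\<^sup>2 = (\<Sum>j<p. (data_partial f (x(i := y)) i j)\<^sup>2)"
proof -
  have pd: "partial_deriv j g y = data_partial f (x(i := y)) i j" if "y \<in> Rn p" "j < p" for y j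
    unfolding partial_deriv_def g_def by (rule DERIV_imp_deriv[OF data_partial_deriv[OF f that(1) i that(2)]])
  show "C1_Rn p g"
    unfolding C1_Rn_def
  proof (intro allI impI conjI ballI)
    fix j y assume j: "j < p" and y: "y \<in> Rn p"
    show "(\<lambda>t. g (y(j := t))) differentiable (at (y j))"
      unfolding g_def using data_partial_deriv[OF f y i j] by (rule differentiableI[OF has_field_derivative_imp_has_derivative])
  next
    fix j assume j: "j < p"
    have "continuous_on (Rn p) (\<lambda>y. data_partial f (x(i := y)) i j)"
    proof (rule continuous_on_RnI)
      fix y0 and F :: "(nat \<Rightarrow> real) filter" assume lim: "\<And>k. k < p \<Longrightarrow> ((\<lambda>y. y k) \<longlongrightarrow> y0 k) F"
      show "((\<lambda>y. data_partial f (x(i := y)) i j) \<longlongrightarrow> data_partial f (x(i := y0)) i j) F"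
      proof (rule data_partial_tendsto[OF f])
        fix i' k assume "k < p"
        then show "((\<lambda>a. (x(i := a)) i' k) \<longlongrightarrow> (x(i := y0)) i' k) F"
          using lim by (cases "i' = i") auto
      qed
    qed
    then show "continuous_on (Rn p) (partial_deriv j g)"
      by (rule continuous_on_cong[THEN iffD1, rotated 2]) (auto simp: pd j)
  qed
  show "y \<in> Rn p \<Longrightarrow> (norm_Rn p (gradient p g y))\<^sup>2 = (\<Sum>j<p. (data_partial f (x(i := y)) i j)\<^sup>2)"
    by (simp add: norm_Rn_sq inner_Rn_self gradient_def pd)
qed

text \<open>The Poincare inequality of each column, applied with the other columns frozen, supplies the majorants in
the Efron--Stein inequality.  Their sum is the full gradient with respect to the data, and
\<open>E |\<nabla>f|\<^sup>2 \<le> (E |\<nabla>f|\<^sup>4)\<^bsup>1/2\<^esup>\<close> gives the stated norm.\<close>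

lemma variance_theta_hat:
  fixes M :: "'w measure" and X :: "nat \<Rightarrow> 'w \<Rightarrow> nat \<Rightarrow> real"
  assumes "prob_space M"
    and indep: "prob_space.indep_vars M (\<lambda>_. borel_Rn p) X {..<n}"
    and CP: "CP \<ge> 0"
    and poincare: "\<And>i g. i < n \<Longrightarrow> C1_Rn p g \<Longrightarrow>
        (\<integral>\<^sup>+\<omega>. ennreal ((norm_Rn p (gradient p g (X i \<omega>)))\<^sup>2) \<partial>M) < \<infinity> \<Longrightarrow>
        ext_variance M (\<lambda>\<omega>. g (X i \<omega>)) \<le>
          ennreal CP * (\<integral>\<^sup>+\<omega>. ennreal ((norm_Rn p (gradient p g (X i \<omega>)))\<^sup>2) \<partial>M)"
    and f: "C1_Rn p f"
  shows "ext_variance M (\<lambda>\<omega>. f (\<theta>h (\<lambda>i. X i \<omega>))) \<le>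
           ennreal (CP * lip) * (ennreal (1 / real n) *
             (Lk_norm M 4 (\<lambda>\<omega>. norm_Rn p (gradient p f (\<theta>h (\<lambda>i. X i \<omega>)))))\<^sup>2)"
proof -
  interpret prob_space M by fact
  let ?P = "PiM {..<n} (\<lambda>_. borel_Rn p)"
  define \<mu> where "\<mu> i = distr M (borel_Rn p) (X i)" for i
  let ?Q = "PiM {..<n} \<mu>"
  define Y where "Y \<omega> = (\<lambda>i\<in>{..<n}. X i \<omega>)" for \<omega>
  have X_meas: "X i \<in> measurable M (borel_Rn p)" if "i < n" for i
    using indep that unfolding indep_vars_def2 by auto
  have Y_meas: "Y \<in> measurable M ?P"
    unfolding Y_def by (rule measurable_restrict) (use X_meas in auto)
  have sets_Q: "sets ?Q = sets ?P" by (intro sets_PiM_cong) (auto simp: \<mu>_def)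
  have space_Q: "space ?Q = space ?P" by (rule sets_eq_imp_space_eq[OF sets_Q])
  have distr_Y: "distr M ?P Y = ?Q"
    using indep_vars_iff_distr_eq_PiM'[of "{..<n}" X "\<lambda>_. borel_Rn p"] indep X_meas n
    unfolding Y_def \<mu>_def by (auto simp: lessThan_empty_iff)
  have prob_\<mu>: "prob_space (\<mu> i)" if "i < n" for i
    unfolding \<mu>_def by (rule prob_space_distr[OF X_meas[OF that]])
  have X_Rn: "X i \<omega> \<in> Rn p" if "i < n" "\<omega> \<in> space M" for i \<omega>
    using measurable_space[OF X_meas[OF that(1)] that(2)] by (auto simp: space_PiM Rn_def)
  define \<Phi> where "\<Phi> x = f (\<theta>h x)" for x
  define S where "S i x = (\<Sum>j<p. (data_partial f x i j)\<^sup>2)" for i x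
  define N2 where "N2 x = (norm_Rn p (gradient p f (\<theta>h x)))\<^sup>2" for x
  have N2_eq: "N2 x = (\<Sum>k<p. (partial_deriv k f (\<theta>h x))\<^sup>2)" for x
    by (simp add: N2_def norm_Rn_sq inner_Rn_self gradient_def)
  have f_cont: "continuous_on (Rn p) f" by (rule C1_Rn_continuous[OF f])
  have pd_cont: "continuous_on (Rn p) (partial_deriv k f)" if "k < p" for k
    using f that by (simp add: C1_Rn_def)
  obtain B where B: "\<bar>\<Phi> x\<bar> \<le> B" for x
    using bounded_at_theta_hat[OF f_cont] unfolding \<Phi>_def by blast
  have "\<exists>D. \<forall>x. N2 x \<le> D"
  proof -
    have "\<forall>k\<in>{..<p}. \<exists>D. \<forall>x. \<bar>partial_deriv k f (\<theta>h x)\<bar> \<le> D"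
      using bounded_at_theta_hat[OF pd_cont] by blast
    from bchoice[OF this] obtain D where D: "\<forall>k\<in>{..<p}. \<forall>x. \<bar>partial_deriv k f (\<theta>h x)\<bar> \<le> D k" ..
    have "N2 x \<le> (\<Sum>k<p. (D k)\<^sup>2)" for x
      unfolding N2_eq
    proof (rule sum_mono)
      fix k assume "k \<in> {..<p}"
      then show "(partial_deriv k f (\<theta>h x))\<^sup>2 \<le> (D k)\<^sup>2"
        using D power_mono[OF _ abs_ge_zero, of "partial_deriv k f (\<theta>h x)" "D k" 2] by simp
    qed
    then show ?thesis by blast
  qed
  then obtain D where D: "N2 x \<le> D" for x by blast
  have N2_nonneg: "N2 x \<ge> 0" for x by (simp add: N2_def)
  have S_nonneg: "S i x \<ge> 0" for i x by (simp add: S_def sum_nonneg)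
  have S_sum: "(\<Sum>i<n. S i x) \<le> lip / real n * N2 x" for x
    unfolding S_def N2_def by (rule data_gradient_le)
  have lip_n: "lip / real n \<ge> 0" using lip_nonneg by simp
  have S_le: "S i x \<le> lip / real n * D" if "i < n" for i x
  proof -
    have "S i x \<le> (\<Sum>i<n. S i x)" using that S_nonneg by (intro member_le_sum) auto
    also have "\<dots> \<le> lip / real n * D" using S_sum mult_left_mono[OF D lip_n] by (rule order_trans)
    finally show ?thesis .
  qed
  have \<Phi>_meas [measurable]: "\<Phi> \<in> borel_measurable ?P"
    unfolding \<Phi>_def
    by (rule borel_measurable_coordinatewise_continuous, rule continuous_on_Rn_tendsto[OF f_cont theta_hat_Rn])
      (auto intro: theta_hat_tendsto simp: theta_hat_Rn)
  have S_meas [measurable]: "S i \<in> borel_measurable ?P" for i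
    unfolding S_def
    by (rule borel_measurable_coordinatewise_continuous) (intro tendsto_intros data_partial_tendsto[OF f])
  have N2_meas [measurable]: "N2 \<in> borel_measurable ?P"
    unfolding N2_eq
  proof (rule borel_measurable_coordinatewise_continuous, intro tendsto_sum tendsto_power)
    fix k F and x0 :: "nat \<Rightarrow> nat \<Rightarrow> real"
    assume "k \<in> {..<p}" "\<And>i k. i < n \<Longrightarrow> k < p \<Longrightarrow> ((\<lambda>x. x i k) \<longlongrightarrow> x0 i k) F"
    then show "((\<lambda>x. partial_deriv k f (\<theta>h x)) \<longlongrightarrow> partial_deriv k f (\<theta>h x0)) F"
      by (intro continuous_on_Rn_tendsto[OF pd_cont theta_hat_Rn]) (auto intro: theta_hat_tendsto simp: theta_hat_Rn)
  qed
  have upd_meas: "(\<lambda>y. x(i := y)) \<in> measurable (borel_Rn p) ?P" if "x \<in> space ?P" "i < n" for x i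
  proof -
    have "(\<lambda>y. \<lambda>k\<in>{..<n}. if k = i then y else x k) \<in> measurable (borel_Rn p) ?P"
      using that by (intro measurable_restrict) (auto simp: space_PiM PiE_def Pi_def)
    moreover have "(\<lambda>k\<in>{..<n}. if k = i then y else x k) = x(i := y)" for y
      using that by (auto simp: fun_eq_iff space_PiM PiE_def extensional_def)
    ultimately show ?thesis by simp
  qed
  have slice: "(\<integral>y. (\<Phi> (x(i := y)))\<^sup>2 \<partial>\<mu> i) - (\<integral>y. \<Phi> (x(i := y)) \<partial>\<mu> i)\<^sup>2 \<le> (\<integral>y. CP * S i (x(i := y)) \<partial>\<mu> i)"
    if i: "i < n" and x: "x \<in> space ?P" for i x
  proof -
    define g where "g y = \<Phi> (x(i := y))" for y
    define s where "s y = S i (x(i := y))" for y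
    have g_meas: "g \<in> borel_measurable (borel_Rn p)" unfolding g_def using measurable_compose[OF upd_meas[OF x i] \<Phi>_meas] .
    have s_meas: "s \<in> borel_measurable (borel_Rn p)" unfolding s_def using measurable_compose[OF upd_meas[OF x i] S_meas] .
    have g_C1: "C1_Rn p g" unfolding g_def \<Phi>_def by (rule C1_Rn_one_column(1)[OF f i])
    have grad: "(norm_Rn p (gradient p g y))\<^sup>2 = s y" if "y \<in> Rn p" for y
      unfolding g_def \<Phi>_def s_def S_def by (rule C1_Rn_one_column(2)[OF f i that])
    have gX: "(\<lambda>\<omega>. g (X i \<omega>)) \<in> borel_measurable M" and sX: "(\<lambda>\<omega>. s (X i \<omega>)) \<in> borel_measurable M"
      using measurable_compose[OF X_meas[OF i]] g_meas s_meas by blast+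
    have s_int: "integrable M (\<lambda>\<omega>. s (X i \<omega>))"
      using sX by (rule integrable_const_bound[where B = "lip / real n * D", rotated])
        (auto intro!: AE_I2 simp: s_def S_le[OF i, simplified] S_nonneg)
    have "(\<integral>\<^sup>+\<omega>. ennreal ((norm_Rn p (gradient p g (X i \<omega>)))\<^sup>2) \<partial>M) = (\<integral>\<^sup>+\<omega>. ennreal (s (X i \<omega>)) \<partial>M)"
      by (intro nn_integral_cong) (simp add: grad X_Rn[OF i])
    also have "\<dots> = ennreal (\<integral>\<omega>. s (X i \<omega>) \<partial>M)"
      using s_int by (intro nn_integral_eq_integral) (auto simp: s_def S_nonneg)
    finally have nn: "(\<integral>\<^sup>+\<omega>. ennreal ((norm_Rn p (gradient p g (X i \<omega>)))\<^sup>2) \<partial>M) = ennreal (\<integral>\<omega>. s (X i \<omega>) \<partial>M)" .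
    have "ennreal ((\<integral>\<omega>. (g (X i \<omega>))\<^sup>2 \<partial>M) - (\<integral>\<omega>. g (X i \<omega>) \<partial>M)\<^sup>2) \<le> ennreal CP * ennreal (\<integral>\<omega>. s (X i \<omega>) \<partial>M)"
      using poincare[OF i g_C1] B
      unfolding nn ext_variance_bounded[OF \<open>prob_space M\<close> gX, of B, unfolded g_def, OF B, folded g_def] by simp
    also have "\<dots> = ennreal (CP * (\<integral>\<omega>. s (X i \<omega>) \<partial>M))"
      using CP by (simp add: ennreal_mult' s_def S_nonneg)
    finally have "(\<integral>\<omega>. (g (X i \<omega>))\<^sup>2 \<partial>M) - (\<integral>\<omega>. g (X i \<omega>) \<partial>M)\<^sup>2 \<le> CP * (\<integral>\<omega>. s (X i \<omega>) \<partial>M)"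
      using CP by (subst (asm) ennreal_le_iff) (auto simp: s_def S_nonneg intro!: mult_nonneg_nonneg integral_nonneg)
    then show ?thesis
      unfolding g_def[symmetric] s_def[symmetric] \<mu>_def
      using integral_distr[OF X_meas[OF i], of g] integral_distr[OF X_meas[OF i], of "\<lambda>y. (g y)\<^sup>2"]
        integral_distr[OF X_meas[OF i], of s] g_meas s_meas by simp
  qed
  have "(\<integral>x. (\<Phi> x)\<^sup>2 \<partial>?Q) - (\<integral>x. \<Phi> x \<partial>?Q)\<^sup>2 \<le> (\<Sum>i<n. \<integral>x. CP * S i x \<partial>?Q)"
  proof (rule Efron_Stein)
    show "\<Phi> \<in> borel_measurable ?Q" "\<And>i. (\<lambda>x. CP * S i x) \<in> borel_measurable ?Q"
      unfolding measurable_cong_sets[OF sets_Q refl] by measurable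
    show "\<bar>CP * S i x\<bar> \<le> CP * (lip / real n * D)" if "i \<in> {..<n}" for i x
      using that mult_left_mono[OF S_le[of i x] CP] S_nonneg[of i x] CP by (simp add: abs_mult)
  qed (use prob_\<mu> B slice space_Q in auto)
  also have "\<dots> = (\<Sum>i<n. \<integral>\<omega>. CP * S i (Y \<omega>) \<partial>M)"
    unfolding distr_Y[symmetric] by (intro sum.cong refl integral_distr Y_meas) measurable
  also have "\<dots> = (\<integral>\<omega>. (\<Sum>i<n. CP * S i (Y \<omega>)) \<partial>M)"
  proof (rule Bochner_Integration.integral_sum[symmetric])
    fix i assume "i \<in> {..<n}"
    then show "integrable M (\<lambda>\<omega>. CP * S i (Y \<omega>))"
      using measurable_compose[OF Y_meas S_meas[of i]] S_le[of i] S_nonneg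
      by (intro integrable_mult_right integrable_const_bound[where B = "lip / real n * D"]) auto
  qed
  also have "\<dots> \<le> (\<integral>\<omega>. CP * (lip / real n) * N2 (Y \<omega>) \<partial>M)"
  proof (rule integral_mono)
    show "integrable M (\<lambda>\<omega>. \<Sum>i<n. CP * S i (Y \<omega>))"
      using measurable_compose[OF Y_meas S_meas] S_le S_nonneg
      by (intro Bochner_Integration.integrable_sum integrable_mult_right integrable_const_bound[where B = "lip / real n * D"]) auto
    show "integrable M (\<lambda>\<omega>. CP * (lip / real n) * N2 (Y \<omega>))"
      using measurable_compose[OF Y_meas N2_meas] D N2_nonneg
      by (intro integrable_mult_right integrable_const_bound[where B = D]) auto
    show "(\<Sum>i<n. CP * S i (Y \<omega>)) \<le> CP * (lip / real n) * N2 (Y \<omega>)" for \<omega>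
      using mult_left_mono[OF S_sum CP, of "Y \<omega>"] by (simp add: sum_distrib_left mult.assoc)
  qed
  also have "\<dots> = CP * (lip / real n) * (\<integral>\<omega>. N2 (Y \<omega>) \<partial>M)" by simp
  finally have var_Q: "(\<integral>x. (\<Phi> x)\<^sup>2 \<partial>?Q) - (\<integral>x. \<Phi> x \<partial>?Q)\<^sup>2 \<le> CP * (lip / real n) * (\<integral>\<omega>. N2 (Y \<omega>) \<partial>M)" .
  have \<theta>Y: "\<theta>h (\<lambda>i. X i \<omega>) = \<theta>h (Y \<omega>)" for \<omega>
    unfolding Y_def by (rule theta_hat_restrict[symmetric])
  have N2Y_meas: "(\<lambda>\<omega>. N2 (Y \<omega>)) \<in> borel_measurable M" by (rule measurable_compose[OF Y_meas N2_meas])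
  have N2_int: "integrable M (\<lambda>\<omega>. N2 (Y \<omega>))"
    using N2Y_meas D N2_nonneg by (intro integrable_const_bound[where B = D]) auto
  have N4_int: "integrable M (\<lambda>\<omega>. (N2 (Y \<omega>))\<^sup>2)"
    using N2Y_meas D N2_nonneg by (intro integrable_const_bound[where B = "D\<^sup>2"]) (auto intro!: AE_I2 power_mono)
  have "(\<integral>\<omega>. N2 (Y \<omega>) \<partial>M)\<^sup>2 \<le> (\<integral>\<omega>. (N2 (Y \<omega>))\<^sup>2 \<partial>M)"
    using variance_eq[OF N2_int N4_int] variance_positive[of "\<lambda>\<omega>. N2 (Y \<omega>)"] by simp
  then have N2_le: "(\<integral>\<omega>. N2 (Y \<omega>) \<partial>M) \<le> sqrt (\<integral>\<omega>. (N2 (Y \<omega>))\<^sup>2 \<partial>M)"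
    by (rule real_le_rsqrt)
  have powr4: "\<bar>norm_Rn p (gradient p f (\<theta>h (Y \<omega>)))\<bar> powr 4 = (N2 (Y \<omega>))\<^sup>2" for \<omega>
  proof (cases "norm_Rn p (gradient p f (\<theta>h (Y \<omega>))) = 0")
    case False
    then have "\<bar>norm_Rn p (gradient p f (\<theta>h (Y \<omega>)))\<bar> powr real 4 = \<bar>norm_Rn p (gradient p f (\<theta>h (Y \<omega>)))\<bar> ^ 4"
      by (intro powr_realpow) (simp add: less_le L2_set_nonneg)
    then show ?thesis by (simp add: N2_def power_even_abs)
  qed (simp add: N2_def)
  have Lk: "(Lk_norm M 4 (\<lambda>\<omega>. norm_Rn p (gradient p f (\<theta>h (Y \<omega>)))))\<^sup>2 = ennreal (sqrt (\<integral>\<omega>. (N2 (Y \<omega>))\<^sup>2 \<partial>M))"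
  proof -
    define I where "I = (\<integral>\<omega>. (N2 (Y \<omega>))\<^sup>2 \<partial>M)"
    have I: "I \<ge> 0" by (simp add: I_def)
    have "(I powr (1 / 4))\<^sup>2 = sqrt I"
      using I by (cases "I = 0") (simp_all add: power2_eq_square powr_add[symmetric] powr_half_sqrt)
    then show ?thesis
      using N4_int unfolding Lk_norm_def powr4 I_def[symmetric] by (simp add: ennreal_power)
  qed
  have "ext_variance M (\<lambda>\<omega>. f (\<theta>h (\<lambda>i. X i \<omega>))) = ext_variance M (\<lambda>\<omega>. \<Phi> (Y \<omega>))"
    by (simp add: \<Phi>_def \<theta>Y)
  also have "\<dots> = ennreal ((\<integral>\<omega>. (\<Phi> (Y \<omega>))\<^sup>2 \<partial>M) - (\<integral>\<omega>. \<Phi> (Y \<omega>) \<partial>M)\<^sup>2)"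
    by (rule ext_variance_bounded[OF \<open>prob_space M\<close> measurable_compose[OF Y_meas \<Phi>_meas] B])
  also have "(\<integral>\<omega>. (\<Phi> (Y \<omega>))\<^sup>2 \<partial>M) - (\<integral>\<omega>. \<Phi> (Y \<omega>) \<partial>M)\<^sup>2 = (\<integral>x. (\<Phi> x)\<^sup>2 \<partial>?Q) - (\<integral>x. \<Phi> x \<partial>?Q)\<^sup>2"
    unfolding distr_Y[symmetric] using integral_distr[OF Y_meas, of \<Phi>] integral_distr[OF Y_meas, of "\<lambda>x. (\<Phi> x)\<^sup>2"] by simp
  also have "ennreal \<dots> \<le> ennreal (CP * lip * (1 / real n * sqrt (\<integral>\<omega>. (N2 (Y \<omega>))\<^sup>2 \<partial>M)))"
  proof (rule ennreal_leI)
    have "CP * (lip / real n) * (\<integral>\<omega>. N2 (Y \<omega>) \<partial>M) \<le> CP * (lip / real n) * sqrt (\<integral>\<omega>. (N2 (Y \<omega>))\<^sup>2 \<partial>M)"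
      using N2_le CP lip_n by (intro mult_left_mono mult_nonneg_nonneg)
    then show "(\<integral>x. (\<Phi> x)\<^sup>2 \<partial>?Q) - (\<integral>x. \<Phi> x \<partial>?Q)\<^sup>2 \<le> CP * lip * (1 / real n * sqrt (\<integral>\<omega>. (N2 (Y \<omega>))\<^sup>2 \<partial>M))"
      using var_Q by simp
  qed
  also have "\<dots> = ennreal (CP * lip) * (ennreal (1 / real n) * ennreal (sqrt (\<integral>\<omega>. (N2 (Y \<omega>))\<^sup>2 \<partial>M)))"
    using CP lip_nonneg by (simp add: ennreal_mult[symmetric])
  finally show ?thesis unfolding \<theta>Y Lk .
qed

end

lemma loewner_ge_scaled_id_mono:
  assumes "loewner_ge_scaled_id p A c" "c' \<le> c"
  shows "loewner_ge_scaled_id p A c'"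
  unfolding loewner_ge_scaled_id_def
proof
  fix v
  have "c' * inner_Rn p v v \<le> c * inner_Rn p v v"
    using assms(2) by (intro mult_right_mono inner_Rn_self_nonneg)
  then show "c' * inner_Rn p v v \<le> (\<Sum>i<p. \<Sum>j<p. v i * A i j * v j)"
    using loewner_ge_scaled_idD[OF assms(1), of v] by linarith
qed

text \<open>How the hypotheses \<open>\<kappa>\<^sub>L\<inverse> = O(1)\<close> and \<open>\<kappa>\<inverse> = O(1)\<close> enter: they provide one convexity constant for almost all \<open>n\<close>.\<close>

lemma inverse_bigo_1_imp_lower_bound:
  fixes \<kappa> :: "nat \<Rightarrow> real"
  assumes "(\<lambda>n. 1 / \<kappa> n) \<in> O(\<lambda>_. 1)" and pos: "\<And>n. n \<ge> 1 \<Longrightarrow> \<kappa> n > 0"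
  shows "\<exists>c>0. \<forall>\<^sub>F n in sequentially. c \<le> \<kappa> n"
proof -
  obtain c where c: "c > 0" "\<forall>\<^sub>F n in sequentially. norm (1 / \<kappa> n) \<le> c * norm (1 :: real)"
    using landau_o.bigE[OF assms(1)] by blast
  have "\<forall>\<^sub>F n in sequentially. 1 / c \<le> \<kappa> n"
    using c(2) eventually_ge_at_top[of 1]
  proof eventually_elim
    case (elim n)
    then show ?case using pos[of n] c(1) by (simp add: field_simps)
  qed
  then show ?thesis using c(1) by (intro exI[of _ "1 / c"]) simp
qed

section \<open>The variance bound for sequences of problems\<close>

theorem corollary3p15:
  fixes p :: "nat \<Rightarrow> nat"
    and M :: "nat \<Rightarrow> 'w measure"
    and X :: "nat \<Rightarrow> nat \<Rightarrow> 'w \<Rightarrow> nat \<Rightarrow> real"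
    and L :: "nat \<Rightarrow> real \<Rightarrow> real"
    and \<rho> :: "nat \<Rightarrow> (nat \<Rightarrow> real) \<Rightarrow> real"
    and f :: "nat \<Rightarrow> (nat \<Rightarrow> real) \<Rightarrow> real"
    and \<theta>\<^sub>h :: "nat \<Rightarrow> 'w \<Rightarrow> nat \<Rightarrow> real"
  defines "\<theta>\<^sub>h \<equiv> \<lambda>n \<omega>. theta_hat n (p n) (\<lambda>i. X n i \<omega>) (L n) (\<rho> n)"
  assumes prob: "\<And>n. n \<ge> 1 \<Longrightarrow> prob_space (M n)"
    and indep: "\<And>n. n \<ge> 1 \<Longrightarrow>
          prob_space.indep_vars (M n) (\<lambda>_. borel_Rn (p n)) (X n) {..<n}"
    and A1: "(\<lambda>n. real (p n)) \<in> O(\<lambda>n. real n)"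
    and A2: "(\<lambda>n. \<bar>deriv (L n) 0\<bar>) \<in> O(\<lambda>_. 1)"
            "(\<lambda>n. norm_Rn (p n) (gradient (p n) (\<rho> n) (zero_Rn (p n)))) \<in> O(\<lambda>_. 1)"
    and A3: "\<And>n i j. n \<ge> 1 \<Longrightarrow> i < n \<Longrightarrow> j < p n \<Longrightarrow> integrable (M n) (\<lambda>\<omega>. X n i \<omega> j)"
            "\<exists>C>0. \<forall>\<^sub>F n in sequentially. \<forall>i<n.
               norm_Rn (p n) (\<lambda>j. \<integral>\<omega>. X n i \<omega> j \<partial>M n) \<le> C"
    and A4: "\<exists>C\<^sub>P :: nat \<Rightarrow> real. C\<^sub>P \<in> O(\<lambda>_. 1) \<and>
               (\<forall>n\<ge>1. C\<^sub>P n \<ge> 0 \<and>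
                 (\<forall>i<n. \<forall>g. C1_Rn (p n) g \<longrightarrow>
                    (\<integral>\<^sup>+\<omega>. ennreal ((norm_Rn (p n) (gradient (p n) g (X n i \<omega>)))\<^sup>2) \<partial>M n) < \<infinity> \<longrightarrow>
                    ext_variance (M n) (\<lambda>\<omega>. g (X n i \<omega>)) \<le>
                      ennreal (C\<^sub>P n) *
                      (\<integral>\<^sup>+\<omega>. ennreal ((norm_Rn (p n) (gradient (p n) g (X n i \<omega>)))\<^sup>2) \<partial>M n)))"
    and A5_L: "\<And>n. n \<ge> 1 \<Longrightarrow>
                 L n C1_differentiable_on UNIV \<and> deriv (L n) C1_differentiable_on UNIV"
              "\<exists>C>0. \<forall>\<^sub>F n in sequentially. \<forall>t. \<bar>deriv (deriv (L n)) t\<bar> \<le> C"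
              "\<exists>\<kappa>\<^sub>L :: nat \<Rightarrow> real. (\<lambda>n. 1 / \<kappa>\<^sub>L n) \<in> O(\<lambda>_. 1) \<and>
                 (\<forall>n\<ge>1. \<kappa>\<^sub>L n > 0 \<and> (\<forall>t. deriv (deriv (L n)) t \<ge> \<kappa>\<^sub>L n))"
    and A5_\<rho>: "\<And>n. n \<ge> 1 \<Longrightarrow> C2_Rn (p n) (\<rho> n)"
              "\<exists>\<kappa> :: nat \<Rightarrow> real. (\<lambda>n. 1 / \<kappa> n) \<in> O(\<lambda>_. 1) \<and>
                 (\<forall>n\<ge>1. \<kappa> n > 0 \<and>
                    (\<forall>\<theta>\<in>Rn (p n). loewner_ge_scaled_id (p n) (hessian (\<rho> n) \<theta>) (\<kappa> n)))"
    and f_C1: "\<And>n. n \<ge> 1 \<Longrightarrow> C1_Rn (p n) (f n)"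
  shows "\<exists>C>0. \<forall>\<^sub>F n in sequentially.
           ext_variance (M n) (\<lambda>\<omega>. f n (\<theta>\<^sub>h n \<omega>)) \<le>
             ennreal C * (ennreal (1 / real n) *
               (Lk_norm (M n) 4 (\<lambda>\<omega>. norm_Rn (p n) (gradient (p n) (f n) (\<theta>\<^sub>h n \<omega>))))\<^sup>2)"
proof -
  obtain l0 where l0: "\<forall>\<^sub>F n in sequentially. norm \<bar>deriv (L n) 0\<bar> \<le> l0 * norm (1 :: real)"
    using landau_o.bigE[OF A2(1)] by blast
  obtain r0 where r0: "\<forall>\<^sub>F n in sequentially.
      norm (norm_Rn (p n) (gradient (p n) (\<rho> n) (zero_Rn (p n)))) \<le> r0 * norm (1 :: real)"
    using landau_o.bigE[OF A2(2)] by blast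
  obtain C\<^sub>P where C\<^sub>P: "C\<^sub>P \<in> O(\<lambda>_. 1 :: real)" and C\<^sub>P0: "\<And>n. n \<ge> 1 \<Longrightarrow> C\<^sub>P n \<ge> 0"
    and poincare: "\<And>n i g. n \<ge> 1 \<Longrightarrow> i < n \<Longrightarrow> C1_Rn (p n) g \<Longrightarrow>
        (\<integral>\<^sup>+\<omega>. ennreal ((norm_Rn (p n) (gradient (p n) g (X n i \<omega>)))\<^sup>2) \<partial>M n) < \<infinity> \<Longrightarrow>
        ext_variance (M n) (\<lambda>\<omega>. g (X n i \<omega>)) \<le>
          ennreal (C\<^sub>P n) * (\<integral>\<^sup>+\<omega>. ennreal ((norm_Rn (p n) (gradient (p n) g (X n i \<omega>)))\<^sup>2) \<partial>M n)"
    using A4 by blast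
  obtain cP where cP: "\<forall>\<^sub>F n in sequentially. norm (C\<^sub>P n) \<le> cP * norm (1 :: real)"
    using landau_o.bigE[OF C\<^sub>P] by blast
  obtain CL where CL: "\<forall>\<^sub>F n in sequentially. \<forall>t. \<bar>deriv (deriv (L n)) t\<bar> \<le> CL"
    using A5_L(2) by blast
  obtain \<kappa>\<^sub>L :: "nat \<Rightarrow> real" where "(\<lambda>n. 1 / \<kappa>\<^sub>L n) \<in> O(\<lambda>_. 1)" and \<kappa>\<^sub>L_pos: "\<And>n. n \<ge> 1 \<Longrightarrow> \<kappa>\<^sub>L n > 0"
    and \<kappa>\<^sub>L: "\<And>n t. n \<ge> 1 \<Longrightarrow> deriv (deriv (L n)) t \<ge> \<kappa>\<^sub>L n"
    using A5_L(3) by blast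
  then obtain kL where kL: "kL > 0" "\<forall>\<^sub>F n in sequentially. kL \<le> \<kappa>\<^sub>L n"
    using inverse_bigo_1_imp_lower_bound by blast
  obtain \<kappa> :: "nat \<Rightarrow> real" where "(\<lambda>n. 1 / \<kappa> n) \<in> O(\<lambda>_. 1)" and \<kappa>_pos: "\<And>n. n \<ge> 1 \<Longrightarrow> \<kappa> n > 0"
    and \<kappa>: "\<And>n \<theta>. n \<ge> 1 \<Longrightarrow> \<theta> \<in> Rn (p n) \<Longrightarrow> loewner_ge_scaled_id (p n) (hessian (\<rho> n) \<theta>) (\<kappa> n)"
    using A5_\<rho>(2) by blast
  then obtain k where k: "k > 0" "\<forall>\<^sub>F n in sequentially. k \<le> \<kappa> n"
    using inverse_bigo_1_imp_lower_bound by blast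
  define \<Lambda> where "\<Lambda> = regularized_erm.lip kL CL k l0 r0"
  define C where "C = \<bar>cP * \<Lambda>\<bar> + 1"
  have "C > 0" by (simp add: C_def add_nonneg_pos)
  moreover have "\<forall>\<^sub>F n in sequentially.
           ext_variance (M n) (\<lambda>\<omega>. f n (\<theta>\<^sub>h n \<omega>)) \<le>
             ennreal C * (ennreal (1 / real n) *
               (Lk_norm (M n) 4 (\<lambda>\<omega>. norm_Rn (p n) (gradient (p n) (f n) (\<theta>\<^sub>h n \<omega>))))\<^sup>2)"
    using l0 r0 cP CL kL(2) k(2) eventually_ge_at_top[of 1]
  proof eventually_elim
    case (elim n)
    then have n: "n \<ge> 1" by simp
    interpret regularized_erm n "p n" "L n" "\<rho> n" kL CL k l0 r0
    proof
      show "kL \<le> deriv (deriv (L n)) t" for t using elim(5) \<kappa>\<^sub>L[OF n, of t] by simp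
      show "deriv (deriv (L n)) t \<le> CL" for t using elim(4) abs_le_D1 by blast
      show "loewner_ge_scaled_id (p n) (hessian (\<rho> n) \<theta>) k" if "\<theta> \<in> Rn (p n)" for \<theta>
        by (rule loewner_ge_scaled_id_mono[OF \<kappa>[OF n that] elim(6)])
    qed (use n A5_L(1) A5_\<rho>(1) kL(1) k(1) elim(1,2) in auto)
    have "ext_variance (M n) (\<lambda>\<omega>. f n (\<theta>\<^sub>h n \<omega>)) \<le>
             ennreal (C\<^sub>P n * lip) * (ennreal (1 / real n) *
               (Lk_norm (M n) 4 (\<lambda>\<omega>. norm_Rn (p n) (gradient (p n) (f n) (\<theta>\<^sub>h n \<omega>))))\<^sup>2)"
      unfolding \<theta>\<^sub>h_def
      by (rule variance_theta_hat[OF prob[OF n] indep[OF n] C\<^sub>P0[OF n] poincare[OF n] f_C1[OF n]])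
    also have "\<dots> \<le> ennreal C * (ennreal (1 / real n) *
               (Lk_norm (M n) 4 (\<lambda>\<omega>. norm_Rn (p n) (gradient (p n) (f n) (\<theta>\<^sub>h n \<omega>))))\<^sup>2)"
    proof (intro mult_right_mono ennreal_leI)
      have "C\<^sub>P n * lip \<le> cP * lip" using elim(3) lip_nonneg by (intro mult_right_mono) auto
      then show "C\<^sub>P n * lip \<le> C" by (simp add: C_def \<Lambda>_def)
    qed simp
    finally show ?case .
  qed
  ultimately show ?thesis by blast
qed

end
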